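(* Let $x^*\in\mathbb{R}^n$ be a local minimizer of the problem (SOCP), and suppose that at least one of the following holds: (a) for every sequence $\rho_k\to+\infty$ and every sequence $x^k\to x^*$ such that each $x^k$ is a local minimizer of the penalty function $F_k$, setting $\omega_i^k:=\rho_k\Pi_{\mathcal{K}_i}(-g_i(x^k))$, the sequence $\{[\omega_i^k]_0\}_{k\in\tilde N_i}$ is bounded for every $i\in I_B(x^* )$, where $\tilde N_i:=\{k\mid g_i(x^k)\in\mathbb{R}^{m_i}\setminus(\mathcal{K}_i\cup-\mathcal{K}_i)\}$; or (b) the feasibility measure $Q(x):=\frac12\|h(x)\|^2+\frac12\|\Pi_{\mathcal{K}}(-g(x))\|^2$ satisfies the generalized Lojasiewicz inequality at $x^*$. Then $x^*$ satisfies the AKKT2 conditions.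
   Context: Problem (SOCP): minimize $f(x)$ over $x\in\mathbb{R}^n$ subject to $g_i(x)\in\mathcal{K}_i$ ($i=1,\dots,r$) and $h(x)=0$, where $f:\mathbb{R}^n\to\mathbb{R}$, $h:\mathbb{R}^n\to\mathbb{R}^p$, $g_i:\mathbb{R}^n\to\mathbb{R}^{m_i}$ are twice continuously differentiable. A vector $w\in\mathbb{R}^\ell$ is written $w=(w_0,\overline{w})\in\mathbb{R}\times\mathbb{R}^{\ell-1}$, and $[w]_0:=w_0$. $\mathcal{K}_i:=\{(w_0,\overline w)\in\mathbb{R}\times\mathbb{R}^{m_i-1}\mid w_0\ge\|\overline w\|\}$ if $m_i>1$ and $\mathcal{K}_i:=\{w\in\mathbb{R}\mid w\ge0\}$ if $m_i=1$; $\mathcal{K}:=\mathcal{K}_1\times\dots\times\mathcal{K}_r$, $g:=(g_1,\dots,g_r)$. $\|\cdot\|$ is the Euclidean norm, $\Pi_C$ is the Euclidean projection onto $C$, $D$ denotes the Jacobian (rows are transposed gradients). $\mathrm{int}(\mathcal{K}_i)$ is the set where $w_0>\|\overline w\|$, and $\mathrm{bd}^+(\mathcal{K}_i)$ the set where $w_0=\|\overline w\|\ne0$. For feasible $x$: $I_0(x):=\{i\mid g_i(x)=0\}$, $I_B(x):=\{i\mid g_i(x)\in\mathrm{bd}^+(\mathcal{K}_i)\}$, $I_I(x):=\{i\mid g_i(x)\in\mathrm{int}(\mathcal{K}_i)\}$. Lagrangian: $L(x,\mu,\omega):=f(x)+\langle h(x),\mu\rangle-\langle g(x),\omega\rangle$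 for $\mu\in\mathbb{R}^p$, $\omega=(\omega_1,\dots,\omega_r)\in\mathcal{K}$; $\nabla_x L,\nabla_x^2L$ are its gradient and Hessian in $x$. Penalty function: $F_k(x):=f(x)+\frac14\|x-x^*\|^4+\frac{\rho_k}{2}\left(\sum_{i=1}^r\|\Pi_{\mathcal{K}_i}(-g_i(x))\|^2+\|h(x)\|^2\right)$. Generalized Lojasiewicz inequality for a differentiable function $Q$ at $x^*$: there exist $\delta>0$ and $\vartheta:B(x^*,\delta)\to\mathbb{R}$ ($B(x^*,\delta)$ the Euclidean ball) with $\lim_{x\to x^*}\vartheta(x)=0$ and $|Q(x)-Q(x^* )|\le\vartheta(x)\|\nabla Q(x)\|$ for $x\in B(x^*,\delta)$. $\Gamma_i:=\begin{pmatrix}1&0^\top\\0&-I_{m_i-1}\end{pmatrix}$, $\tilde g_i(x):=(\|\overline{g_i(x)}\|,\overline{g_i(x)})$, and, relative to $x^*$, $\sigma(x,\omega):=\sum_{i\in I_B(x^* )}-\frac{[\omega_i]_0}{[g_i(x)]_0}Dg_i(x)^\top\Gamma_iDg_i(x)$. AKKT conditions: sequences $x^k\to x^*$, $\{\mu^k\}\subset\mathbb{R}^p$, $\{\omega^k\}\subset\mathcal{K}$ satisfy the AKKT conditions at a feasible $x^*$ if $\nabla_xL(x^k,\mu^k,\omega^k)\to0$; for $i\in I_I(x^* )$, $\omega_i^k\to0$; and for $i\in I_B(x^* )$, either $\omega_i^k\to0$, or $\omega_i^k\in\mathrm{bd}^+(\mathcal{K}_i)$ for all $k$ with $\overline{\omega_i^k}/\|\overline{\omega_i^k}\|\to-\overline{g_i(x^*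 )}/\|\overline{g_i(x^* )}\|$. AKKT2 conditions: a feasible point $x^*$ satisfies AKKT2 if there exist sequences $x^k\to x^*$, $\{\mu^k\}\subset\mathbb{R}^p$, $\{\omega^k\}\subset\mathcal{K}$ satisfying the AKKT conditions and, in addition, sequences $\{\eta^k\}\subset\mathbb{R}^p$, $\{\theta_i^k\}\subset\mathbb{R}$ ($i\in I_0(x^* )$), $\{\gamma_i^k\}\subset\mathbb{R}$ ($i\in I_B(x^* )$), $\{\delta_k\}\subset\mathbb{R}_+$ with $\delta_k\to0$, such that for all sufficiently large $k$ and all $d\in\mathbb{R}^n$, $$d^\top\Big(\nabla_x^2L(x^k,\mu^k,\omega^k)+\sigma(x^k,\omega^k)+\sum_{i=1}^p\eta_i^k\nabla h_i(x^k)\nabla h_i(x^k)^\top+\sum_{i\in I_B(x^* )}\gamma_i^k(Dg_i(x^k)^\top\Gamma_i\tilde g_i(x^k))(Dg_i(x^k)^\top\Gamma_i\tilde g_i(x^k))^\top+\sum_{i\in I_0(x^* )}\theta_i^kDg_i(x^k)^\top Dg_i(x^k)+\delta_kI_n\Big)d\ge0.$$ *)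

theory Defs
  imports "HOL-Analysis.Analysis"
begin

subsection \<open>Differential calculus\<close>

definition twice_cont_diff :: "('a::real_normed_vector \<Rightarrow> 'b::real_normed_vector) \<Rightarrow> bool" where
  "twice_cont_diff f \<longleftrightarrow>
     (\<exists>(f' :: 'a \<Rightarrow> 'a \<Rightarrow>\<^sub>L 'b) (f'' :: 'a \<Rightarrow> 'a \<Rightarrow>\<^sub>L ('a \<Rightarrow>\<^sub>L 'b)).
        (\<forall>x. (f has_derivative blinfun_apply (f' x)) (at x)) \<and>
        (\<forall>x. (f' has_derivative blinfun_apply (f'' x)) (at x)) \<and>
        continuous_on UNIV f'')"

definition grad :: "('a::real_inner \<Rightarrow> real) \<Rightarrow> 'a \<Rightarrow> 'a" where
  "grad f x = (THE D. GDERIV f x :> D)"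

text \<open>Matrices acting on the space of the variable are represented by linear operators:
  the Hessian is the derivative of the gradient, the Jacobian \<open>Dg(x)\<close> is
  \<open>frechet_derivative g (at x)\<close>, its transpose is the \<open>adjoint\<close>, and \<open>outer v\<close> is \<open>v v\<^sup>T\<close>.\<close>

definition hess :: "('a::real_inner \<Rightarrow> real) \<Rightarrow> 'a \<Rightarrow> 'a \<Rightarrow> 'a" where
  "hess f x = frechet_derivative (grad f) (at x)"

definition outer :: "'a::real_inner \<Rightarrow> 'a \<Rightarrow> 'a" where
  "outer v d = (v \<bullet> d) *\<^sub>R v"

definition local_minimizer_on :: "'a::metric_space set \<Rightarrow> ('a \<Rightarrow> real) \<Rightarrow> 'a \<Rightarrow> bool" where
  "local_minimizer_on S f x \<longleftrightarrow> x \<in> S \<and> (\<exists>e>0. \<forall>y \<in> S \<inter> ball x e. f x \<le> f y)"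


subsection \<open>Second-order cones of varying dimension\<close>

text \<open>The blocks \<open>g\<^sub>i(x)\<close> have different dimensions \<open>m\<^sub>i \<ge> 1\<close>.  All of them are
  placed in one type \<open>real \<times> (real^'d)\<close>, a vector being \<open>w = (w\<^sub>0, tail)\<close> with \<open>w\<^sub>0 = fst w\<close>
  and tail \<open>snd w\<close>.  For a set \<open>J\<close> of tail coordinates, \<open>soc_space J\<close> is the copy of
  \<open>\<real>\<^sup>m\<close>, \<open>m = 1 + card J\<close>, formed by the vectors whose tail is supported on \<open>J\<close>;
  the inner product and norm restrict to the Euclidean ones.  \<open>J = {}\<close> is allowed and gives
  \<open>m = 1\<close>; then the tail is \<open>0\<close> and \<open>soc J\<close> is the half-line \<open>w\<^sub>0 \<ge> 0\<close>.\<close>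

type_synonym 'd svec = "real \<times> (real, 'd) vec"

definition soc_space :: "'d::finite set \<Rightarrow> 'd svec set" where
  "soc_space J = {w. \<forall>j. j \<notin> J \<longrightarrow> snd w $ j = 0}"

definition soc :: "'d::finite set \<Rightarrow> 'd svec set" where
  "soc J = {w \<in> soc_space J. fst w \<ge> norm (snd w)}"

text \<open>The interior is meant relative to \<open>soc_space J\<close>.\<close>

definition soc_int :: "'d::finite set \<Rightarrow> 'd svec set" where
  "soc_int J = {w \<in> soc_space J. fst w > norm (snd w)}"

definition soc_bdp :: "'d::finite set \<Rightarrow> 'd svec set" where
  "soc_bdp J = {w \<in> soc_space J. fst w = norm (snd w) \<and> fst w \<noteq> 0}"

definition reflect_tail :: "('d::finite) svec \<Rightarrow> 'd svec" where  \<comment> \<open>the matrix \<open>\<Gamma>\<^sub>i\<close>\<close>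
  "reflect_tail w = (fst w, - snd w)"


subsection \<open>The problem\<close>

text \<open>Minimize \<open>f x\<close> subject to \<open>g x $ i \<in> soc (J i)\<close> for all \<open>i\<close>, and \<open>h x = 0\<close>.  The types
  \<open>'n\<close>, \<open>'p\<close>, \<open>'r\<close> index the variables, the equality constraints and the cones; \<open>J i\<close> is the
  set of tail coordinates of the \<open>i\<close>-th block.\<close>

definition prod_soc :: "('r \<Rightarrow> 'd::finite set) \<Rightarrow> ('d svec^'r::finite) set" where
  "prod_soc J = {w. \<forall>i. w $ i \<in> soc (J i)}"

definition feasible_set ::
  "('r \<Rightarrow> 'd::finite set) \<Rightarrow> (real^'n::finite \<Rightarrow> 'd svec^'r::finite)
    \<Rightarrow> (real^'n \<Rightarrow> real^'p::finite) \<Rightarrow> (real^'n) set" where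
  "feasible_set J g h = {x. (\<forall>i. g x $ i \<in> soc (J i)) \<and> h x = 0}"

definition I_zero :: "('a \<Rightarrow> ('d::finite) svec^'r::finite) \<Rightarrow> 'a \<Rightarrow> 'r set" where
  "I_zero g x = {i. g x $ i = 0}"

definition I_bd ::
  "('r \<Rightarrow> 'd::finite set) \<Rightarrow> ('a \<Rightarrow> 'd svec^'r::finite) \<Rightarrow> 'a \<Rightarrow> 'r set" where
  "I_bd J g x = {i. g x $ i \<in> soc_bdp (J i)}"

definition I_int ::
  "('r \<Rightarrow> 'd::finite set) \<Rightarrow> ('a \<Rightarrow> 'd svec^'r::finite) \<Rightarrow> 'a \<Rightarrow> 'r set" where
  "I_int J g x = {i. g x $ i \<in> soc_int (J i)}"

definition lagrangian ::
  "(real^'n::finite \<Rightarrow> real) \<Rightarrow> (real^'n \<Rightarrow> ('d::finite) svec^'r::finite)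
    \<Rightarrow> (real^'n \<Rightarrow> real^'p::finite)
    \<Rightarrow> real^'n \<Rightarrow> real^'p \<Rightarrow> 'd svec^'r \<Rightarrow> real" where
  "lagrangian f g h x \<mu> \<omega> = f x + h x \<bullet> \<mu> - g x \<bullet> \<omega>"

definition penalty ::
  "('r \<Rightarrow> 'd::finite set) \<Rightarrow> (real^'n::finite \<Rightarrow> real)
    \<Rightarrow> (real^'n \<Rightarrow> 'd svec^'r::finite) \<Rightarrow> (real^'n \<Rightarrow> real^'p::finite)
    \<Rightarrow> real^'n \<Rightarrow> real \<Rightarrow> real^'n \<Rightarrow> real" where
  "penalty J f g h xs \<rho> x =
     f x + 1/4 * norm (x - xs) ^ 4
       + \<rho> / 2 * ((\<Sum>i\<in>UNIV. (norm (closest_point (soc (J i)) (- (g x $ i))))\<^sup>2) + (norm (h x))\<^sup>2)"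

definition feas_measure ::
  "('r \<Rightarrow> 'd::finite set) \<Rightarrow> (real^'n::finite \<Rightarrow> 'd svec^'r::finite)
    \<Rightarrow> (real^'n \<Rightarrow> real^'p::finite) \<Rightarrow> real^'n \<Rightarrow> real" where
  "feas_measure J g h x =
     1/2 * (norm (h x))\<^sup>2 + 1/2 * (norm (closest_point (prod_soc J) (- g x)))\<^sup>2"

definition gen_lojasiewicz :: "('a::real_inner \<Rightarrow> real) \<Rightarrow> 'a \<Rightarrow> bool" where
  "gen_lojasiewicz Q xs \<longleftrightarrow>
     (\<exists>\<delta>>0. \<exists>\<theta> :: 'a \<Rightarrow> real. (\<theta> \<longlongrightarrow> 0) (at xs) \<and>
        (\<forall>x \<in> ball xs \<delta>. \<bar>Q x - Q xs\<bar> \<le> \<theta> x * norm (grad Q x)))"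


subsection \<open>AKKT and AKKT2\<close>

definition Dcomp ::
  "(real^'n::finite \<Rightarrow> ('d::finite) svec^'r::finite) \<Rightarrow> 'r \<Rightarrow> real^'n
    \<Rightarrow> real^'n \<Rightarrow> 'd svec" where
  "Dcomp g i x = frechet_derivative (\<lambda>y. g y $ i) (at x)"

definition g_tilde ::
  "(real^'n::finite \<Rightarrow> ('d::finite) svec^'r::finite) \<Rightarrow> 'r \<Rightarrow> real^'n \<Rightarrow> 'd svec" where
  "g_tilde g i x = (norm (snd (g x $ i)), snd (g x $ i))"

definition sigma_term ::
  "('r \<Rightarrow> 'd::finite set) \<Rightarrow> (real^'n::finite \<Rightarrow> 'd svec^'r::finite)
    \<Rightarrow> real^'n \<Rightarrow> real^'n \<Rightarrow> 'd svec^'r \<Rightarrow> real^'n \<Rightarrow> real^'n" where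
  "sigma_term J g xs x \<omega> d =
     (\<Sum>i\<in>I_bd J g xs. (- (fst (\<omega> $ i) / fst (g x $ i))) *\<^sub>R
        adjoint (Dcomp g i x) (reflect_tail (Dcomp g i x d)))"

definition AKKT_sequences ::
  "('r \<Rightarrow> 'd::finite set) \<Rightarrow> (real^'n::finite \<Rightarrow> real)
    \<Rightarrow> (real^'n \<Rightarrow> 'd svec^'r::finite) \<Rightarrow> (real^'n \<Rightarrow> real^'p::finite) \<Rightarrow> real^'n
    \<Rightarrow> (nat \<Rightarrow> real^'n) \<Rightarrow> (nat \<Rightarrow> real^'p) \<Rightarrow> (nat \<Rightarrow> 'd svec^'r) \<Rightarrow> bool" where
  "AKKT_sequences J f g h xs x \<mu> \<omega> \<longleftrightarrow>
     xs \<in> feasible_set J g h \<and>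
     x \<longlonglongrightarrow> xs \<and>
     (\<forall>k. \<omega> k \<in> prod_soc J) \<and>
     (\<lambda>k. grad (\<lambda>y. lagrangian f g h y (\<mu> k) (\<omega> k)) (x k)) \<longlonglongrightarrow> 0 \<and>
     (\<forall>i \<in> I_int J g xs. (\<lambda>k. \<omega> k $ i) \<longlonglongrightarrow> 0) \<and>
     (\<forall>i \<in> I_bd J g xs.
        (\<lambda>k. \<omega> k $ i) \<longlonglongrightarrow> 0 \<or>
        (\<forall>k. \<omega> k $ i \<in> soc_bdp (J i)) \<and>
        (\<lambda>k. snd (\<omega> k $ i) /\<^sub>R norm (snd (\<omega> k $ i)))
          \<longlonglongrightarrow> - (snd (g xs $ i) /\<^sub>R norm (snd (g xs $ i))))"

definition AKKT2 ::
  "('r \<Rightarrow> 'd::finite set) \<Rightarrow> (real^'n::finite \<Rightarrow> real)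
    \<Rightarrow> (real^'n \<Rightarrow> 'd svec^'r::finite) \<Rightarrow> (real^'n \<Rightarrow> real^'p::finite) \<Rightarrow> real^'n
    \<Rightarrow> bool" where
  "AKKT2 J f g h xs \<longleftrightarrow>
     (\<exists>(x :: nat \<Rightarrow> real^'n) (\<mu> :: nat \<Rightarrow> real^'p) (\<omega> :: nat \<Rightarrow> 'd svec^'r)
       (\<eta> :: nat \<Rightarrow> real^'p) (\<theta> :: nat \<Rightarrow> 'r \<Rightarrow> real) (\<gamma> :: nat \<Rightarrow> 'r \<Rightarrow> real) (\<delta> :: nat \<Rightarrow> real).
        AKKT_sequences J f g h xs x \<mu> \<omega> \<and>
        (\<forall>k. \<delta> k \<ge> 0) \<and> \<delta> \<longlonglongrightarrow> 0 \<and>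
        (\<forall>\<^sub>F k in sequentially. \<forall>d :: real^'n.
           d \<bullet> (hess (\<lambda>y. lagrangian f g h y (\<mu> k) (\<omega> k)) (x k) d
              + sigma_term J g xs (x k) (\<omega> k) d
              + (\<Sum>i\<in>UNIV. (\<eta> k $ i) *\<^sub>R outer (grad (\<lambda>y. h y $ i) (x k)) d)
              + (\<Sum>i\<in>I_bd J g xs. \<gamma> k i *\<^sub>R
                   outer (adjoint (Dcomp g i (x k)) (reflect_tail (g_tilde g i (x k)))) d)
              + (\<Sum>i\<in>I_zero g xs. \<theta> k i *\<^sub>R
                   adjoint (Dcomp g i (x k)) (Dcomp g i (x k) d))
              + \<delta> k *\<^sub>R d) \<ge> 0))"

end

theory Submission
  imports Defs
begin

text \<open>
  The point \<open>xs\<close> is approached by minimizers of external penalizations, and the approximate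
  conditions are the exact second-order conditions at those minimizers.

  On a small ball around \<open>xs\<close> the function
  \<open>f x + 1/4 * norm (x - xs) ^ 4 + \<rho> / 2 * ((norm (h x))\<^sup>2 + (\<Sum>i. T\<^sub>i (g x $ i)))\<close> is minimized, where
  \<open>T\<^sub>i\<close> is the squared distance to the cone, written explicitly for the blocks that lie on the nonzero
  boundary of their cone at \<open>xs\<close> and dropped for interior blocks.  As \<open>\<rho>\<close> tends to infinity the
  minimizers tend to \<open>xs\<close>, because \<open>xs\<close> is a local solution and the quartic term makes it a strict one
  (\<open>penalty_minimizers_converge\<close>).

  The penalized function is only once differentiable.  A second-order condition is nevertheless
  available: a minimum persists when the function is replaced by a larger smooth function with the
  same value at the minimizer.  For a block at the apex, freezing the projection gives a quadratic
  majorant, whose Hessian is a multiple of the identity and yields the \<open>\<theta>\<close>-terms.  For a boundary block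
  the majorant is half the square of \<open>norm (snd w) - fst w\<close>, smooth near \<open>xs\<close>.  All derivatives are
  taken along lines, so only curves with first and second derivatives occur
  (\<open>two_jet\<close>, \<open>majorized_at\<close>, \<open>penalized_second_order_conditions\<close>).  Weighted with
  \<open>\<rho> / 2\<close>, the majorants have as gradients the negatives of the multipliers
  \<open>\<omega>\<^sub>i\<close>, so the gradient of the Lagrangian equals minus that of the quartic term and tends to \<open>0\<close>.

  It remains to bring the curvature of a boundary block to the form
  \<open>\<sigma> + \<gamma> v v\<^sup>T + \<delta> I\<close>.  The two differ by a sign-definite part, by multiples of \<open>v v\<^sup>T\<close>, and by a mixed term
  that is a product of \<open>v \<bullet> d\<close> with another linear form.  Since \<open>\<gamma>\<close> may be as large as one likes, any
  fixed \<open>\<delta> > 0\<close> suffices to absorb the mixed term (\<open>boundary_curvature_bound\<close>), and \<open>\<delta>\<close> can then be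
  chosen to tend to \<open>0\<close> along the sequence.
\<close>

section \<open>Second-order behaviour along a line\<close>

text \<open>The pair \<open>(a, b)\<close> is the first and second derivative at \<open>0\<close> of a curve that is
  differentiable near \<open>0\<close>.  Second-order necessary conditions in several variables only need
  restrictions to lines, and the product and chain rules are much simpler for such jets than for
  Hessians.\<close>

definition two_jet :: "(real \<Rightarrow> 'v::real_normed_vector) \<Rightarrow> 'v \<Rightarrow> 'v \<Rightarrow> bool" where
  "two_jet u a b \<longleftrightarrow> (\<exists>u'. (\<forall>\<^sub>F t in nhds 0. (u has_vector_derivative u' t) (at t)) \<and>
     u' 0 = a \<and> (u' has_vector_derivative b) (at 0))"

lemma two_jetI:
  assumes "\<forall>\<^sub>F t in nhds 0. (u has_vector_derivative u' t) (at t)"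
    and "u' 0 = a" and "(u' has_vector_derivative b) (at 0)"
  shows "two_jet u a b"
  using assms unfolding two_jet_def by blast

lemma two_jetE:
  assumes "two_jet u a b"
  obtains u' where "\<forall>\<^sub>F t in nhds 0. (u has_vector_derivative u' t) (at t)"
    and "u' 0 = a" and "(u' has_vector_derivative b) (at 0)" and "(u has_vector_derivative a) (at 0)"
  using assms eventually_nhds_x_imp_x unfolding two_jet_def by blast

lemma two_jet_continuous:
  assumes "two_jet u a b"
  shows "(u \<longlongrightarrow> u 0) (nhds 0)"
proof -
  obtain u' where "(u has_vector_derivative a) (at 0)" using assms by (rule two_jetE)
  then have "isCont u 0" by (rule has_vector_derivative_continuous)
  then show ?thesis by (simp add: isCont_def tendsto_at_iff_tendsto_nhds)
qed

lemma two_jet_const: "two_jet (\<lambda>t. c) 0 0"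
  by (rule two_jetI[where u' = "\<lambda>_. 0"]) auto

lemma has_vector_derivative_line: "((\<lambda>t. y + t *\<^sub>R d) has_vector_derivative d) (at t)"
  unfolding has_vector_derivative_def by (rule derivative_eq_intros refl | simp)+

lemma two_jet_line: "two_jet (\<lambda>t. y + t *\<^sub>R d) d 0"
  by (rule two_jetI[where u' = "\<lambda>_. d"])
     (simp_all add: has_vector_derivative_line)

lemma two_jet_add:
  assumes "two_jet u a b" and "two_jet v a' b'"
  shows "two_jet (\<lambda>t. u t + v t) (a + a') (b + b')"
proof -
  obtain u' where u: "\<forall>\<^sub>F t in nhds 0. (u has_vector_derivative u' t) (at t)"
    "u' 0 = a" "(u' has_vector_derivative b) (at 0)" using assms(1) by (rule two_jetE)
  obtain v' where v: "\<forall>\<^sub>F t in nhds 0. (v has_vector_derivative v' t) (at t)"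
    "v' 0 = a'" "(v' has_vector_derivative b') (at 0)" using assms(2) by (rule two_jetE)
  show ?thesis
  proof (rule two_jetI[where u' = "\<lambda>t. u' t + v' t"])
    show "\<forall>\<^sub>F t in nhds 0. ((\<lambda>t. u t + v t) has_vector_derivative u' t + v' t) (at t)"
      using u(1) v(1) by eventually_elim (rule has_vector_derivative_add)
  qed (use u v in \<open>auto intro: has_vector_derivative_add\<close>)
qed

lemma two_jet_sum:
  assumes "finite I" and "\<And>i. i \<in> I \<Longrightarrow> two_jet (u i) (a i) (b i)"
  shows "two_jet (\<lambda>t. \<Sum>i\<in>I. u i t) (\<Sum>i\<in>I. a i) (\<Sum>i\<in>I. b i)"
  using assms by (induction I rule: finite_induct) (auto intro: two_jet_add two_jet_const)

lemma two_jet_linear: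
  assumes "bounded_linear T" and "two_jet u a b"
  shows "two_jet (\<lambda>t. T (u t)) (T a) (T b)"
proof -
  obtain u' where u: "\<forall>\<^sub>F t in nhds 0. (u has_vector_derivative u' t) (at t)"
    "u' 0 = a" "(u' has_vector_derivative b) (at 0)" using assms(2) by (rule two_jetE)
  show ?thesis
  proof (rule two_jetI[where u' = "\<lambda>t. T (u' t)"])
    show "\<forall>\<^sub>F t in nhds 0. ((\<lambda>t. T (u t)) has_vector_derivative T (u' t)) (at t)"
      using u(1) by eventually_elim (rule bounded_linear.has_vector_derivative[OF assms(1)])
  qed (use u in \<open>auto intro: bounded_linear.has_vector_derivative[OF assms(1)]\<close>)
qed

lemmas two_jet_fst = two_jet_linear[OF bounded_linear_fst]
lemmas two_jet_snd = two_jet_linear[OF bounded_linear_snd]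
lemmas two_jet_mult_right = two_jet_linear[OF bounded_linear_mult_right]
lemmas two_jet_inner_left = two_jet_linear[OF bounded_linear_inner_left]

lemma two_jet_diff:
  assumes "two_jet u a b" and "two_jet v a' b'"
  shows "two_jet (\<lambda>t. u t - v t) (a - a') (b - b')"
  using two_jet_add[OF assms(1) two_jet_linear[OF bounded_linear_minus[OF bounded_linear_ident] assms(2)]]
  by simp

lemma has_vector_derivative_inner:
  fixes u v :: "real \<Rightarrow> 'v::real_inner"
  assumes "(u has_vector_derivative u') (at t)" and "(v has_vector_derivative v') (at t)"
  shows "((\<lambda>t. u t \<bullet> v t) has_vector_derivative u t \<bullet> v' + u' \<bullet> v t) (at t)"
  using bounded_bilinear.has_vector_derivative[OF bounded_bilinear_inner assms] .

lemma two_jet_inner: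
  fixes u v :: "real \<Rightarrow> 'v::real_inner"
  assumes "two_jet u a b" and "two_jet v a' b'"
  shows "two_jet (\<lambda>t. u t \<bullet> v t) (u 0 \<bullet> a' + a \<bullet> v 0) (u 0 \<bullet> b' + 2 * (a \<bullet> a') + b \<bullet> v 0)"
proof -
  obtain u' where u: "\<forall>\<^sub>F t in nhds 0. (u has_vector_derivative u' t) (at t)"
    "u' 0 = a" "(u' has_vector_derivative b) (at 0)" "(u has_vector_derivative a) (at 0)"
    using assms(1) by (rule two_jetE)
  obtain v' where v: "\<forall>\<^sub>F t in nhds 0. (v has_vector_derivative v' t) (at t)"
    "v' 0 = a'" "(v' has_vector_derivative b') (at 0)" "(v has_vector_derivative a') (at 0)"
    using assms(2) by (rule two_jetE)
  show ?thesis
  proof (rule two_jetI[where u' = "\<lambda>t. u t \<bullet> v' t + u' t \<bullet> v t"])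
    show "\<forall>\<^sub>F t in nhds 0. ((\<lambda>t. u t \<bullet> v t) has_vector_derivative u t \<bullet> v' t + u' t \<bullet> v t) (at t)"
      using u(1) v(1) by eventually_elim (rule has_vector_derivative_inner)
    have "((\<lambda>t. u t \<bullet> v' t + u' t \<bullet> v t) has_vector_derivative
       ((u 0 \<bullet> b' + a \<bullet> v' 0) + (u' 0 \<bullet> a' + b \<bullet> v 0))) (at 0)"
      by (intro has_vector_derivative_add has_vector_derivative_inner u v)
    then show "((\<lambda>t. u t \<bullet> v' t + u' t \<bullet> v t) has_vector_derivative
       u 0 \<bullet> b' + 2 * (a \<bullet> a') + b \<bullet> v 0) (at 0)"
      by (simp add: u v algebra_simps)
  qed (simp add: u v)
qed

lemma two_jet_inner_self:
  fixes u :: "real \<Rightarrow> 'v::real_inner"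
  assumes "two_jet u a b"
  shows "two_jet (\<lambda>t. u t \<bullet> u t) (2 * (u 0 \<bullet> a)) (2 * (a \<bullet> a) + 2 * (u 0 \<bullet> b))"
  using two_jet_inner[OF assms assms] by (simp add: inner_commute add_ac)

lemma two_jet_half_square:
  fixes u :: "real \<Rightarrow> real"
  assumes "two_jet u a b"
  shows "two_jet (\<lambda>t. (u t)\<^sup>2 / 2) (u 0 * a) (a\<^sup>2 + u 0 * b)"
  using two_jet_mult_right[where x = "1/2", OF two_jet_inner_self[OF assms]]
  by (simp add: power2_eq_square algebra_simps)

lemma has_vector_derivative_norm:
  fixes u :: "real \<Rightarrow> 'v::real_inner"
  assumes "(u has_vector_derivative u') (at t)" and "u t \<noteq> 0"
  shows "((\<lambda>t. norm (u t)) has_vector_derivative (u t \<bullet> u') / norm (u t)) (at t)"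
proof -
  have "((\<lambda>t. norm (u t)) has_derivative (\<lambda>x. (x *\<^sub>R u') \<bullet> sgn (u t))) (at t)"
    using has_derivative_compose[OF assms(1)[unfolded has_vector_derivative_def]
        has_derivative_norm[OF assms(2)]] .
  then show ?thesis
    by (simp add: has_vector_derivative_def sgn_div_norm divide_inverse inner_commute mult_ac)
qed

text \<open>Away from the origin the norm is smooth, with Hessian the orthogonal projection onto
  the complement of the radial direction, divided by the norm.  This is where the curvature of the
  cone comes from.\<close>

lemma two_jet_norm:
  fixes u :: "real \<Rightarrow> 'v::real_inner"
  assumes "two_jet u a b" and nz: "u 0 \<noteq> 0"
  shows "two_jet (\<lambda>t. norm (u t)) (sgn (u 0) \<bullet> a)
    ((norm a ^ 2 - (sgn (u 0) \<bullet> a)\<^sup>2) / norm (u 0) + sgn (u 0) \<bullet> b)"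
proof -
  obtain u' where u: "\<forall>\<^sub>F t in nhds 0. (u has_vector_derivative u' t) (at t)"
    "u' 0 = a" "(u' has_vector_derivative b) (at 0)" "(u has_vector_derivative a) (at 0)"
    using assms(1) by (rule two_jetE)
  have ne: "\<forall>\<^sub>F t in nhds 0. u t \<noteq> 0"
    using two_jet_continuous[OF assms(1)] nz by (rule tendsto_imp_eventually_ne)
  show ?thesis
  proof (rule two_jetI[where u' = "\<lambda>t. (u t \<bullet> u' t) / norm (u t)"])
    show "\<forall>\<^sub>F t in nhds 0. ((\<lambda>t. norm (u t)) has_vector_derivative (u t \<bullet> u' t) / norm (u t)) (at t)"
      using u(1) ne by eventually_elim (rule has_vector_derivative_norm)
    have "((\<lambda>t. (u t \<bullet> u' t) / norm (u t)) has_real_derivative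
       ((u 0 \<bullet> b + a \<bullet> u' 0) * norm (u 0) - (u 0 \<bullet> u' 0) * ((u 0 \<bullet> a) / norm (u 0)))
         / (norm (u 0) * norm (u 0))) (at 0)"
      by (rule DERIV_divide)
         (use nz has_vector_derivative_inner[OF u(4,3)] has_vector_derivative_norm[OF u(4) nz] in
          \<open>auto simp: has_real_derivative_iff_has_vector_derivative\<close>)
    moreover have "((p + norm a ^ 2) * n - q * (q / n)) / (n * n)
        = (norm a ^ 2 - (q / n)\<^sup>2) / n + p / n" if "n \<noteq> 0" for p q n :: real
      using that by (simp add: field_simps power2_eq_square)
    ultimately show "((\<lambda>t. (u t \<bullet> u' t) / norm (u t)) has_vector_derivative
       (norm a ^ 2 - (sgn (u 0) \<bullet> a)\<^sup>2) / norm (u 0) + sgn (u 0) \<bullet> b) (at 0)"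
      using nz by (simp add: has_real_derivative_iff_has_vector_derivative[symmetric] u(2)
          sgn_div_norm power2_norm_eq_inner[symmetric] inverse_eq_divide)
  qed (simp add: u sgn_div_norm divide_inverse)
qed

text \<open>Uniqueness lets the second derivative of the Lagrangian along a line be read off in two ways:
  as the quadratic form of its Hessian, and term by term from \<open>f\<close>, \<open>g\<close> and \<open>h\<close>.\<close>

lemma two_jet_unique:
  assumes "two_jet u a b" and "two_jet u a' b'"
  shows "a = a'" and "b = b'"
proof -
  obtain u' where u: "\<forall>\<^sub>F t in nhds 0. (u has_vector_derivative u' t) (at t)"
    "u' 0 = a" "(u' has_vector_derivative b) (at 0)" "(u has_vector_derivative a) (at 0)"
    using assms(1) by (rule two_jetE)
  obtain v' where v: "\<forall>\<^sub>F t in nhds 0. (u has_vector_derivative v' t) (at t)"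
    "v' 0 = a'" "(v' has_vector_derivative b') (at 0)" "(u has_vector_derivative a') (at 0)"
    using assms(2) by (rule two_jetE)
  show "a = a'" using u(4) v(4) by (rule vector_derivative_unique_at)
  have "\<forall>\<^sub>F t in nhds 0. u' t = v' t"
    using u(1) v(1) by eventually_elim (rule vector_derivative_unique_at)
  then obtain S where "open S" "0 \<in> S" "\<And>t. t \<in> S \<Longrightarrow> u' t = v' t"
    unfolding eventually_nhds by blast
  then have "(v' has_vector_derivative b) (at 0)"
    using has_vector_derivative_transform_within_open[OF u(3)] by blast
  then show "b = b'" using v(3) by (rule vector_derivative_unique_at)
qed

lemma two_jet_local_min:
  fixes u :: "real \<Rightarrow> real"
  assumes jet: "two_jet u a b" and min: "\<forall>\<^sub>F t in nhds 0. u 0 \<le> u t"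
  shows "a = 0" and "b \<ge> 0"
proof -
  obtain u' where u: "\<forall>\<^sub>F t in nhds 0. (u has_vector_derivative u' t) (at t)"
    "u' 0 = a" "(u' has_vector_derivative b) (at 0)" "(u has_vector_derivative a) (at 0)"
    using jet by (rule two_jetE)
  obtain e where e: "e > 0" "\<And>t. \<bar>t\<bar> < e \<Longrightarrow> u 0 \<le> u t \<and> (u has_vector_derivative u' t) (at t)"
    using eventually_conj[OF min u(1)] by (auto simp: eventually_nhds_metric dist_real_def)
  show a: "a = 0"
    using DERIV_local_min[of u a 0 e] e u(4)
    by (auto simp: has_real_derivative_iff_has_vector_derivative)
  show "b \<ge> 0"
  proof (rule ccontr)
    assume "\<not> b \<ge> 0"
    then have "\<exists>s>0. \<forall>t>0. t < s \<longrightarrow> u' (0 + t) < u' 0"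
      using u(3) by (intro DERIV_neg_dec_right)
        (auto simp: has_real_derivative_iff_has_vector_derivative)
    then obtain s where s: "s > 0" "\<And>t. t > 0 \<Longrightarrow> t < s \<Longrightarrow> u' t < 0"
      using u(2) a by auto
    define t where "t = min s e / 2"
    have t: "0 < t" "t < s" "t < e" using s(1) e(1) by (auto simp: t_def)
    have "\<exists>z. 0 < z \<and> z < t \<and> u t - u 0 = (t - 0) * u' z"
      by (rule MVT2) (use t e(2) in \<open>auto simp: has_real_derivative_iff_has_vector_derivative\<close>)
    then obtain z where z: "0 < z" "z < t" "u t - u 0 = t * u' z" by auto
    have "t * u' z < 0" using t z s(2)[of z] by (simp add: mult_pos_neg)
    then show False using z(3) e(2)[of t] t by simp
  qed
qed

lemma twice_cont_diff_linear:
  assumes T: "bounded_linear T" and "twice_cont_diff \<psi>"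
  shows "twice_cont_diff (\<lambda>x. T (\<psi> x))"
proof -
  obtain f' f'' where d: "\<And>x. (\<psi> has_derivative blinfun_apply (f' x)) (at x)"
    "\<And>x. (f' has_derivative blinfun_apply (f'' x)) (at x)" "continuous_on UNIV f''"
    using assms(2) unfolding twice_cont_diff_def by blast
  let ?T = "Blinfun T"
  let ?C = "Blinfun (\<lambda>A. ?T o\<^sub>L A)"
  have C: "blinfun_apply ?C = (\<lambda>A. ?T o\<^sub>L A)"
    by (rule bounded_linear_Blinfun_apply) (rule bounded_bilinear.bounded_linear_right[OF bounded_bilinear_blinfun_compose])
  show ?thesis unfolding twice_cont_diff_def
  proof (intro exI conjI allI)
    fix x
    show "((\<lambda>x. T (\<psi> x)) has_derivative blinfun_apply (?T o\<^sub>L f' x)) (at x)"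
      using bounded_linear.has_derivative[OF T d(1)] 
      by (simp add: blinfun_compose.rep_eq o_def bounded_linear_Blinfun_apply[OF T])
    show "((\<lambda>x. ?T o\<^sub>L f' x) has_derivative blinfun_apply (?C o\<^sub>L f'' x)) (at x)"
      using bounded_linear.has_derivative[OF blinfun.bounded_linear_right[of ?C] d(2)]
      by (simp add: blinfun_compose.rep_eq o_def C)
    show "continuous_on UNIV (\<lambda>x. ?C o\<^sub>L f'' x)" by (intro continuous_intros d)
  qed
qed

lemma twice_cont_diff_add:
  assumes "twice_cont_diff \<phi>" and "twice_cont_diff \<psi>"
  shows "twice_cont_diff (\<lambda>x. \<phi> x + \<psi> x)"
proof -
  obtain f' f'' where d: "\<And>x. (\<phi> has_derivative blinfun_apply (f' x)) (at x)"
    "\<And>x. (f' has_derivative blinfun_apply (f'' x)) (at x)" "continuous_on UNIV f''"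
    using assms(1) unfolding twice_cont_diff_def by blast
  obtain g' g'' where e: "\<And>x. (\<psi> has_derivative blinfun_apply (g' x)) (at x)"
    "\<And>x. (g' has_derivative blinfun_apply (g'' x)) (at x)" "continuous_on UNIV g''"
    using assms(2) unfolding twice_cont_diff_def by blast
  show ?thesis unfolding twice_cont_diff_def
  proof (intro exI conjI allI)
    fix x
    show "((\<lambda>x. \<phi> x + \<psi> x) has_derivative blinfun_apply (f' x + g' x)) (at x)"
      using has_derivative_add[OF d(1) e(1)] by (simp add: plus_blinfun.rep_eq)
    show "((\<lambda>x. f' x + g' x) has_derivative blinfun_apply (f'' x + g'' x)) (at x)"
      using has_derivative_add[OF d(2) e(2)] by (simp add: plus_blinfun.rep_eq)
    show "continuous_on UNIV (\<lambda>x. f'' x + g'' x)" by (intro continuous_intros d e)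
  qed
qed

lemma twice_cont_diff_continuous:
  assumes "twice_cont_diff \<psi>"
  shows "continuous_on S \<psi>"
proof -
  obtain f' where "\<And>x. (\<psi> has_derivative blinfun_apply (f' x)) (at x)"
    using assms unfolding twice_cont_diff_def by blast
  then show ?thesis
    by (intro continuous_at_imp_continuous_on ballI has_derivative_continuous)
qed

lemma twice_cont_diff_line:
  assumes "twice_cont_diff \<psi>"
  obtains B where "two_jet (\<lambda>t. \<psi> (y + t *\<^sub>R d)) (frechet_derivative \<psi> (at y) d) B"
proof -
  obtain f' f'' where D: "\<And>x. (\<psi> has_derivative blinfun_apply (f' x)) (at x)"
    "\<And>x. (f' has_derivative blinfun_apply (f'' x)) (at x)"
    using assms unfolding twice_cont_diff_def by blast
  note line = has_vector_derivative_line[of y d]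
  have 1: "((\<lambda>t. \<psi> (y + t *\<^sub>R d)) has_vector_derivative f' (y + t *\<^sub>R d) d) (at t)" for t
    using vector_derivative_diff_chain_within[OF line has_derivative_at_withinI[OF D(1)]]
    by (simp add: o_def)
  have 2: "((\<lambda>t. f' (y + t *\<^sub>R d)) has_vector_derivative f'' y d) (at 0)"
    using vector_derivative_diff_chain_within[OF line has_derivative_at_withinI[OF D(2)], of 0]
    by (simp add: o_def)
  have 3: "((\<lambda>t. f' (y + t *\<^sub>R d) d) has_vector_derivative f'' y d d) (at 0)"
    by (rule bounded_linear.has_vector_derivative[OF blinfun.bounded_linear_left 2])
  have "two_jet (\<lambda>t. \<psi> (y + t *\<^sub>R d)) (f' y d) (f'' y d d)"
    by (rule two_jetI[where u' = "\<lambda>t. f' (y + t *\<^sub>R d) d"]) (simp_all add: 1 3)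
  then show thesis unfolding frechet_derivative_at[OF D(1)[of y]] by (rule that)
qed

text \<open>This evaluates the definite description behind \<^const>\<open>grad\<close>.\<close>

lemma gradient_eq:
  assumes "(\<phi> has_derivative (\<lambda>e. e \<bullet> D)) (at y)"
  shows "grad \<phi> y = D"
proof -
  have "E = D" if "(\<phi> has_derivative (\<lambda>e. e \<bullet> E)) (at y)" for E
  proof -
    have "\<forall>e. e \<bullet> E = e \<bullet> D" using has_derivative_unique[OF that assms] by (rule fun_cong[THEN allI])
    then show ?thesis by (simp only: vector_eq_ldot)
  qed
  then show ?thesis unfolding grad_def gderiv_def using assms by (intro the_equality)
qed

lemma two_jet_gradient_hessian:
  fixes \<phi> :: "'a::euclidean_space \<Rightarrow> real"
  assumes "twice_cont_diff \<phi>"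
  shows "two_jet (\<lambda>t. \<phi> (y + t *\<^sub>R d)) (d \<bullet> grad \<phi> y) (d \<bullet> hess \<phi> y d)"
proof -
  obtain f' f'' where D: "\<And>x. (\<phi> has_derivative blinfun_apply (f' x)) (at x)"
    "\<And>x. (f' has_derivative blinfun_apply (f'' x)) (at x)"
    using assms unfolding twice_cont_diff_def by blast
  define G where "G = (\<lambda>x. \<Sum>b\<in>Basis. f' x b *\<^sub>R b)"
  have rep: "blinfun_apply (f' x) = (\<lambda>e. e \<bullet> G x)" for x
  proof
    fix e
    have "f' x e = f' x (\<Sum>b\<in>Basis. (e \<bullet> b) *\<^sub>R b)" by (simp add: euclidean_representation)
    also have "\<dots> = (\<Sum>b\<in>Basis. (e \<bullet> b) * f' x b)"
      by (simp add: blinfun.sum_right blinfun.scaleR_right)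
    finally show "f' x e = e \<bullet> G x"
      by (simp add: G_def inner_sum_right mult.commute)
  qed
  have grad: "grad \<phi> = G"
    using gradient_eq D(1) unfolding rep by blast
  have G: "(\<phi> has_derivative (\<lambda>e. e \<bullet> grad \<phi> y)) (at y)" for y
    using D(1)[of y] by (simp only: rep grad)
  have "(grad \<phi> has_derivative (\<lambda>e. \<Sum>b\<in>Basis. f'' y e b *\<^sub>R b)) (at y)"
    unfolding grad G_def
    by (intro has_derivative_sum has_derivative_scaleR_left
        bounded_linear.has_derivative[OF blinfun.bounded_linear_left] D)
  then have H: "(grad \<phi> has_derivative hess \<phi> y) (at y)"
    unfolding hess_def by (rule differentiableI[THEN frechet_derivative_works[THEN iffD1]])
  note line = has_vector_derivative_line[of y d]
  have 1: "((\<lambda>t. \<phi> (y + t *\<^sub>R d)) has_vector_derivative d \<bullet> grad \<phi> (y + t *\<^sub>R d)) (at t)" for t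
    using vector_derivative_diff_chain_within[OF line has_derivative_at_withinI[OF G]]
    by (simp add: o_def)
  have 2: "((\<lambda>t. grad \<phi> (y + t *\<^sub>R d)) has_vector_derivative hess \<phi> y d) (at 0)"
    using vector_derivative_diff_chain_within[OF line[of 0], of "grad \<phi>" "hess \<phi> y"] H
    by (simp add: o_def has_derivative_at_withinI)
  have 3: "((\<lambda>t. d \<bullet> grad \<phi> (y + t *\<^sub>R d)) has_vector_derivative d \<bullet> hess \<phi> y d) (at 0)"
    by (rule bounded_linear.has_vector_derivative[OF bounded_linear_inner_right 2])
  show "two_jet (\<lambda>t. \<phi> (y + t *\<^sub>R d)) (d \<bullet> grad \<phi> y) (d \<bullet> hess \<phi> y d)"
    by (rule two_jetI[where u' = "\<lambda>t. d \<bullet> grad \<phi> (y + t *\<^sub>R d)"]) (simp_all add: 1 3)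
qed

section \<open>Convergence of penalty minimizers\<close>

text \<open>On a small closed ball the penalized function attains its minimum by compactness.  A cluster
  point \<open>z\<close> of the minimizers satisfies \<open>f z + q z \<le> f xs\<close>, and \<open>P z = 0\<close> because \<open>k / 2 * P\<close> stays
  bounded along the minimizers; then \<open>f xs \<le> f z\<close>, and the strictly positive term \<open>q\<close> forces
  \<open>z = xs\<close>.\<close>

lemma penalty_minimizers_converge:
  fixes f P :: "'a::heine_borel \<Rightarrow> real" and q :: "'a \<Rightarrow> real"
  assumes e: "e > 0"
    and cont: "continuous_on (cball xs e) f" "continuous_on (cball xs e) q"
      "continuous_on (cball xs e) P"
    and P: "\<And>z. P z \<ge> 0" "P xs = 0"
    and q: "q xs = 0" "\<And>z. z \<noteq> xs \<Longrightarrow> q z > 0"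
    and min: "\<And>z. z \<in> cball xs e \<Longrightarrow> P z = 0 \<Longrightarrow> f xs \<le> f z"
  obtains x :: "nat \<Rightarrow> 'a" where "x \<longlonglongrightarrow> xs"
    and "\<And>k z. z \<in> cball xs e \<Longrightarrow> f (x k) + q (x k) + real k / 2 * P (x k) \<le> f z + q z + real k / 2 * P z"
proof -
  let ?C = "cball xs e"
  let ?F = "\<lambda>k z. f z + q z + real k / 2 * P z"
  have "\<exists>x\<in>?C. \<forall>z\<in>?C. ?F k x \<le> ?F k z" for k
    by (rule continuous_attains_inf) (use e in \<open>auto intro!: continuous_intros cont\<close>)
  then have "\<forall>k. \<exists>x. x \<in> ?C \<and> (\<forall>z\<in>?C. ?F k x \<le> ?F k z)" by blast
  from choice[OF this] obtain x where x: "\<And>k. x k \<in> ?C" "\<And>k z. z \<in> ?C \<Longrightarrow> ?F k (x k) \<le> ?F k z"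
    by blast
  have xs: "xs \<in> ?C" using e by simp
  have below: "f (x k) + q (x k) \<le> f xs" "real k / 2 * P (x k) \<le> f xs - f (x k)" for k
  proof -
    have "q (x k) \<ge> 0" using q(1) q(2)[of "x k"] by (cases "x k = xs") auto
    moreover have "real k / 2 * P (x k) \<ge> 0" using P by simp
    moreover have "?F k (x k) \<le> f xs"
      using x(2)[OF xs, of k] by (simp only: P(2) q(1) mult_zero_right add_0_right)
    ultimately show "f (x k) + q (x k) \<le> f xs" "real k / 2 * P (x k) \<le> f xs - f (x k)"
      by linarith+
  qed
  have "x \<longlonglongrightarrow> xs"
  proof (rule ccontr)
    assume "\<not> x \<longlonglongrightarrow> xs"
    then obtain \<epsilon> where \<epsilon>: "\<epsilon> > 0" "\<exists>\<^sub>F k in sequentially. \<not> dist (x k) xs < \<epsilon>"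
      unfolding tendsto_iff not_all not_imp not_eventually by blast
    from \<epsilon>(2) have "infinite {k. \<epsilon> \<le> dist (x k) xs}"
      by (simp add: frequently_cofinite[symmetric] cofinite_eq_sequentially not_less)
    then obtain r :: "nat \<Rightarrow> nat" where r: "strict_mono r" "\<And>k. \<epsilon> \<le> dist (x (r k)) xs"
      using infinite_enumerate by blast
    obtain z l where z: "z \<in> ?C" "strict_mono l" "(\<lambda>k. x (r (l k))) \<longlonglongrightarrow> z"
      using compact_cball[of xs e, unfolded compact_def, rule_format, of "\<lambda>k. x (r k)"] x(1)
      unfolding o_def by blast
    define s where "s = (\<lambda>k. r (l k))"
    have s: "filterlim s at_top sequentially"
      unfolding s_def using r(1) z(2) strict_mono_o[of r l] by (auto simp: o_def intro: filterlim_subseq)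
    have xz: "(\<lambda>k. x (s k)) \<longlonglongrightarrow> z" using z(3) by (simp add: s_def)
    have lim: "(\<lambda>k. \<phi> (x (s k))) \<longlonglongrightarrow> \<phi> z" if "continuous_on ?C \<phi>" for \<phi> :: "'a \<Rightarrow> real"
      using continuous_on_tendsto_compose[OF that xz z(1)] x(1) by simp
    note lims = lim[OF cont(1)] lim[OF cont(2)] lim[OF cont(3)]
    have "f z + q z \<le> f xs"
      by (rule tendsto_upperbound[OF tendsto_add[OF lims(1,2)]]) (auto simp: below)
    moreover have "P z = 0"
    proof (rule ccontr)
      assume "P z \<noteq> 0"
      then have pos: "P z / 2 > 0" using P(1)[of z] by simp
      have half: "(\<lambda>k. P (x (s k)) / 2) \<longlonglongrightarrow> P z / 2" by (intro tendsto_intros lims) simp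
      have "filterlim (\<lambda>k. real (s k)) at_top sequentially"
        by (rule filterlim_compose[OF filterlim_real_sequentially s])
      then have "filterlim (\<lambda>k. P (x (s k)) / 2 * real (s k)) at_top sequentially"
        by (rule filterlim_tendsto_pos_mult_at_top[OF half pos])
      then have "\<forall>\<^sub>F k in sequentially. f xs - f z + 1 < P (x (s k)) / 2 * real (s k)"
        unfolding filterlim_at_top_dense by (rule allE)
      moreover have "\<forall>\<^sub>F k in sequentially. f xs - f (x (s k)) < f xs - f z + 1"
        by (rule order_tendstoD[where y = "f xs - f z"]) (intro tendsto_intros lims, simp)
      ultimately have "\<forall>\<^sub>F k in sequentially. False"
        proof eventually_elim
        case (elim k)
        then show ?case using below(2)[of "s k"] by (simp add: mult.commute)
      qed
      then show False by simp
    qed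
    then have "f xs \<le> f z" using min z(1) by blast
    ultimately have "z = xs" using q(2)[of z] by (cases "z = xs") auto
    then have "(\<lambda>k. dist (x (s k)) xs) \<longlonglongrightarrow> 0" using xz by (simp only: tendsto_dist_iff[symmetric])
    then have "\<epsilon> \<le> 0" by (rule tendsto_lowerbound) (auto simp: s_def r)
    then show False using \<epsilon>(1) by simp
  qed
  then show thesis using that x(2) by blast
qed

section \<open>Second-order cones\<close>

lemma closed_soc: "closed (soc J)"
proof -
  have "soc J = (\<Inter>j\<in>-J. {w. snd w $ j = 0}) \<inter> {w. norm (snd w) \<le> fst w}"
    by (auto simp: soc_def soc_space_def)
  then show ?thesis
    by (auto intro!: closed_INT closed_Collect_eq closed_Collect_le continuous_intros)
qed

lemma zero_in_soc: "0 \<in> soc J"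
  by (simp add: soc_def soc_space_def)

lemma soc_add: "v \<in> soc J \<Longrightarrow> w \<in> soc J \<Longrightarrow> v + w \<in> soc J"
  unfolding soc_def soc_space_def using norm_triangle_ineq[of "snd v" "snd w"] by auto

lemma soc_scaleR: "c \<ge> 0 \<Longrightarrow> w \<in> soc J \<Longrightarrow> c *\<^sub>R w \<in> soc J"
  unfolding soc_def soc_space_def by (auto simp: mult_left_mono)

lemma convex_soc: "convex (soc J)"
  by (auto simp: convex_def intro: soc_add soc_scaleR)

text \<open>By the variational inequality of the projection onto a convex cone, the residual lies in the
  dual cone, and the second-order cone is self-dual.  Testing against the reflection of the residual
  is enough to see the latter.\<close>

lemma closest_point_residual_in_soc:
  assumes w: "w \<in> soc_space J"
  shows "closest_point (soc J) w - w \<in> soc J"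
proof -
  define p where "p = closest_point (soc J) w"
  define v where "v = p - w"
  have p: "p \<in> soc J" unfolding p_def
    by (rule closest_point_in_set) (use closed_soc zero_in_soc in auto)
  have v: "v \<in> soc_space J" using w p by (auto simp: v_def soc_def soc_space_def)
  have dual: "0 \<le> v \<bullet> y" if "y \<in> soc J" for y
    using closest_point_dot[OF convex_soc closed_soc soc_add[OF p that], of w]
    by (simp add: v_def p_def inner_diff_left)
  have "norm (snd v) \<le> fst v"
  proof (cases "snd v = 0")
    case True
    have "(1, 0) \<in> soc J" by (simp add: soc_def soc_space_def)
    from dual[OF this] show ?thesis using True by (simp add: inner_prod_def)
  next
    case False
    have "(norm (snd v), - snd v) \<in> soc J" using v by (simp add: soc_def soc_space_def)
    from dual[OF this] have "norm (snd v) * norm (snd v) \<le> fst v * norm (snd v)"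
      by (simp add: inner_prod_def power2_norm_eq_inner[symmetric] power2_eq_square)
    then show ?thesis using False by simp
  qed
  then show ?thesis using v by (simp add: soc_def v_def p_def)
qed

lemma feasible_block_cases:
  assumes "xs \<in> feasible_set J g h"
  shows "i \<in> I_zero g xs \<or> i \<in> I_bd J g xs \<or> i \<in> I_int J g xs"
proof -
  have w: "g xs $ i \<in> soc_space (J i)" "norm (snd (g xs $ i)) \<le> fst (g xs $ i)"
    using assms by (auto simp: feasible_set_def soc_def)
  consider "norm (snd (g xs $ i)) < fst (g xs $ i)"
    | "fst (g xs $ i) = norm (snd (g xs $ i))" "fst (g xs $ i) \<noteq> 0"
    | "fst (g xs $ i) = 0" "norm (snd (g xs $ i)) \<le> 0"
    using w(2) by fastforce
  then show ?thesis
    by cases (use w(1) in \<open>simp_all add: I_zero_def I_bd_def I_int_def soc_int_def soc_bdp_def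
        prod_eq_iff\<close>)
qed

section \<open>Smooth majorants of the nonsmooth penalties\<close>

text \<open>When a sum is minimized at a point, a nonsmooth term \<open>T\<close> of it can be replaced by any larger
  smooth function with the same value at that point: the minimum persists.  The predicate says that such a
  majorant exists along every curve, with gradient \<open>- \<omega>\<close> and Hessian at most \<open>R\<close> at \<open>w\<close>.  Curves
  carry their own acceleration \<open>b\<close>, which meets the gradient in the term \<open>- \<omega> \<bullet> b\<close>; this is what
  later becomes the constraint part of the Hessian of the Lagrangian.\<close>

definition majorized_at :: "('v::real_inner \<Rightarrow> real) \<Rightarrow> 'v \<Rightarrow> 'v \<Rightarrow> ('v \<Rightarrow> real) \<Rightarrow> bool" where
  "majorized_at T w \<omega> R \<longleftrightarrow> (\<forall>u a b. two_jet u a b \<and> u 0 = w \<longrightarrow>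
     (\<exists>M c. M 0 = T w \<and> (\<forall>\<^sub>F t in nhds 0. T (u t) \<le> M t) \<and>
        two_jet M (- (\<omega> \<bullet> a)) c \<and> c \<le> R a - \<omega> \<bullet> b))"

lemma majorized_at_zero: "majorized_at (\<lambda>w. 0) w 0 (\<lambda>a. 0)"
  unfolding majorized_at_def
  by (intro allI impI exI[of _ "\<lambda>t. 0"] exI[of _ 0]) (simp add: two_jet_const)

text \<open>The squared distance to a set is at most the squared distance to any point of it; with the
  projection of \<open>w\<close> as that point there is equality at \<open>w\<close>, and the majorant is quadratic.\<close>

lemma majorized_at_infdist_square:
  fixes K :: "'v::euclidean_space set"
  assumes K: "closed K" "K \<noteq> {}" and \<rho>: "\<rho> \<ge> 0"
  shows "majorized_at (\<lambda>w. \<rho> / 2 * (infdist w K)\<^sup>2) w (\<rho> *\<^sub>R (closest_point K w - w))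
    (\<lambda>a. \<rho> * (norm a)\<^sup>2)"
  unfolding majorized_at_def
proof (intro allI impI, elim conjE)
  fix u :: "real \<Rightarrow> 'v" and a b
  assume u: "two_jet u a b" and u0: "u 0 = w"
  let ?p = "closest_point K w"
  let ?M = "\<lambda>t. \<rho> / 2 * ((u t - ?p) \<bullet> (u t - ?p))"
  have sq: "(u t - ?p) \<bullet> (u t - ?p) = (dist (u t) ?p)\<^sup>2" for t
    by (simp add: dist_norm power2_norm_eq_inner)
  have "infdist w K = dist w ?p"
    using setdist_closest_point[OF K] by (simp add: infdist_eq_setdist)
  then have 1: "?M 0 = \<rho> / 2 * (infdist w K)\<^sup>2" using u0 sq[of 0] by simp
  have "infdist (u t) K \<le> dist (u t) ?p" for t
    using closest_point_in_set[OF K] by (rule infdist_le)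
  then have 2: "\<rho> / 2 * (infdist (u t) K)\<^sup>2 \<le> ?M t" for t
    unfolding sq using \<rho> by (intro mult_left_mono power_mono) (auto simp: infdist_nonneg)
  have "two_jet (\<lambda>t. u t - ?p) a b" using two_jet_diff[OF u two_jet_const[of ?p]] by simp
  from two_jet_mult_right[OF two_jet_inner_self[OF this], of "\<rho> / 2"]
  have 3: "two_jet ?M (- (\<rho> *\<^sub>R (?p - w) \<bullet> a)) (\<rho> * (norm a)\<^sup>2 - \<rho> *\<^sub>R (?p - w) \<bullet> b)"
    using u0 by (simp add: power2_norm_eq_inner inner_diff_left algebra_simps)
  show "\<exists>M c. M 0 = \<rho> / 2 * (infdist w K)\<^sup>2 \<and>
      (\<forall>\<^sub>F t in nhds 0. \<rho> / 2 * (infdist (u t) K)\<^sup>2 \<le> M t) \<and>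
      two_jet M (- (\<rho> *\<^sub>R (?p - w) \<bullet> a)) c \<and> c \<le> \<rho> * (norm a)\<^sup>2 - \<rho> *\<^sub>R (?p - w) \<bullet> b"
    using 1 2 3 by (intro exI[of _ ?M] exI conjI) (auto intro: always_eventually)
qed

text \<open>Near a nonzero boundary point of the cone, the distance to the cone is
  \<open>max 0 (excess w) / sqrt 2\<close>, and \<open>excess\<close> is smooth there.\<close>

definition excess :: "('d::finite) svec \<Rightarrow> real" where
  "excess w = norm (snd w) - fst w"

lemma two_jet_excess:
  fixes u :: "real \<Rightarrow> ('d::finite) svec"
  assumes "two_jet u a b" and "snd (u 0) \<noteq> 0"
  shows "two_jet (\<lambda>t. excess (u t)) (sgn (snd (u 0)) \<bullet> snd a - fst a)
    (((norm (snd a))\<^sup>2 - (sgn (snd (u 0)) \<bullet> snd a)\<^sup>2) / norm (snd (u 0)) + sgn (snd (u 0)) \<bullet> snd b - fst b)"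
  unfolding excess_def
  using two_jet_diff[OF two_jet_norm[OF two_jet_snd[OF assms(1)] assms(2)] two_jet_fst[OF assms(1)]] .

text \<open>For \<open>w\<close> near a nonzero boundary point this is \<open>\<rho>\<close> times the projection of \<open>- w\<close> onto the cone,
  in a form that needs no projection.\<close>

definition boundary_multiplier :: "real \<Rightarrow> ('d::finite) svec \<Rightarrow> 'd svec" where
  "boundary_multiplier \<rho> w = (\<rho> * max 0 (excess w) / 2) *\<^sub>R (1, - sgn (snd w))"

text \<open>For \<open>excess w \<ge> 0\<close>, the Hessian of \<open>\<rho> / 4 * (excess w)\<^sup>2\<close> as a quadratic form in \<open>a\<close>: a rank-one term from
  the square of the gradient of \<open>excess\<close>, and the multiplier times the curvature of the norm.\<close>

definition boundary_curvature :: "real \<Rightarrow> ('d::finite) svec \<Rightarrow> 'd svec \<Rightarrow> real" where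
  "boundary_curvature \<rho> w a = \<rho> / 2 * (sgn (snd w) \<bullet> snd a - fst a)\<^sup>2
     + fst (boundary_multiplier \<rho> w) *
         (((norm (snd a))\<^sup>2 - (sgn (snd w) \<bullet> snd a)\<^sup>2) / norm (snd w))"

lemma boundary_multiplier_in_soc:
  assumes w: "w \<in> soc_space J" and \<rho>: "\<rho> \<ge> 0"
  shows "boundary_multiplier \<rho> w \<in> soc J"
proof -
  have "norm (sgn (snd w)) \<le> 1" by (simp add: norm_sgn)
  moreover have "sgn (snd w) $ j = 0" if "j \<notin> J" for j
    using w that unfolding sgn_div_norm soc_space_def by simp
  ultimately have "(1, - sgn (snd w)) \<in> soc J" by (simp add: soc_def soc_space_def)
  then show ?thesis unfolding boundary_multiplier_def by (rule soc_scaleR[rotated]) (simp add: \<rho>)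
qed

lemma boundary_multiplier_active:
  assumes w: "w \<in> soc_space J" "snd w \<noteq> 0" and \<rho>: "\<rho> > 0" and "excess w > 0"
  shows "boundary_multiplier \<rho> w \<in> soc_bdp J"
    and "sgn (snd (boundary_multiplier \<rho> w)) = - sgn (snd w)"
proof -
  define c where "c = \<rho> * excess w / 2"
  have c: "c > 0" using assms by (simp add: c_def)
  have \<omega>: "boundary_multiplier \<rho> w = (c, - (c *\<^sub>R sgn (snd w)))"
    using assms(4) by (simp add: boundary_multiplier_def c_def)
  have 1: "norm (sgn (snd w)) = 1" using w(2) by (simp add: norm_sgn)
  have "boundary_multiplier \<rho> w \<in> soc_space J"
    using boundary_multiplier_in_soc[OF w(1) less_imp_le[OF \<rho>]] unfolding soc_def by blast
  then show "boundary_multiplier \<rho> w \<in> soc_bdp J"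
    using c 1 by (simp add: soc_bdp_def \<omega>)
  have "snd (boundary_multiplier \<rho> w) /\<^sub>R norm (snd (boundary_multiplier \<rho> w)) = - sgn (snd w)"
    using c 1 by (simp add: \<omega>)
  then show "sgn (snd (boundary_multiplier \<rho> w)) = - sgn (snd w)" 
    by (simp only: sgn_div_norm[of "snd (boundary_multiplier \<rho> w)"])
qed

lemma boundary_multiplier_inactive: "excess w \<le> 0 \<Longrightarrow> boundary_multiplier \<rho> w = 0"
  by (simp add: boundary_multiplier_def zero_prod_def)

lemma sgn_inner_le_norm: "(sgn v \<bullet> a)\<^sup>2 \<le> (norm (a :: 'v::real_inner))\<^sup>2"
proof -
  have "\<bar>sgn v \<bullet> a\<bar> \<le> norm (sgn v) * norm a" by (rule Cauchy_Schwarz_ineq2)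
  also have "\<dots> \<le> norm a" by (simp add: norm_sgn)
  finally show ?thesis by (simp add: abs_le_square_iff[symmetric])
qed

text \<open>Outside the cone and on its boundary the square \<open>(excess w)\<^sup>2\<close> is itself the majorant.  Strictly
  inside, the penalty vanishes in a neighbourhood and \<open>0\<close> serves.\<close>

lemma majorized_at_excess_square:
  fixes w :: "('d::finite) svec"
  assumes nz: "snd w \<noteq> 0" and \<rho>: "\<rho> \<ge> 0"
  shows "majorized_at (\<lambda>w. \<rho> / 2 * ((max 0 (excess w))\<^sup>2 / 2)) w
    (boundary_multiplier \<rho> w) (boundary_curvature \<rho> w)"
  unfolding majorized_at_def
proof (intro allI impI, elim conjE)
  fix u :: "real \<Rightarrow> 'd svec" and a b
  assume u: "two_jet u a b" and u0: "u 0 = w"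
  let ?e = "sgn (snd w)" and ?s = "excess w" and ?\<omega> = "boundary_multiplier \<rho> w"
  let ?T = "\<lambda>w. \<rho> / 2 * ((max 0 (excess w))\<^sup>2 / 2)"
  have jet: "two_jet (\<lambda>t. excess (u t)) (?e \<bullet> snd a - fst a)
    (((norm (snd a))\<^sup>2 - (?e \<bullet> snd a)\<^sup>2) / norm (snd w) + ?e \<bullet> snd b - fst b)"
    using two_jet_excess[OF u] u0 nz by simp
  show "\<exists>M c. M 0 = ?T w \<and> (\<forall>\<^sub>F t in nhds 0. ?T (u t) \<le> M t) \<and>
      two_jet M (- (?\<omega> \<bullet> a)) c \<and> c \<le> boundary_curvature \<rho> w a - ?\<omega> \<bullet> b"
  proof (cases "?s < 0")
    case True
    then have \<omega>: "?\<omega> = 0" by (simp add: boundary_multiplier_def zero_prod_def)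
    have "\<forall>\<^sub>F t in nhds 0. excess (u t) < 0"
      by (rule order_tendstoD(2)[OF two_jet_continuous[OF jet]]) (simp add: u0 True)
    then have "\<forall>\<^sub>F t in nhds 0. ?T (u t) \<le> 0" by eventually_elim simp
    moreover have "0 \<le> boundary_curvature \<rho> w a"
      using \<rho> by (simp add: boundary_curvature_def \<omega>)
    ultimately show ?thesis using True
      by (intro exI[of _ "\<lambda>t. 0"] exI[of _ 0]) (simp add: \<omega> two_jet_const)
  next
    case False
    let ?M = "\<lambda>t. \<rho> / 2 * ((excess (u t))\<^sup>2 / 2)"
    have \<omega>: "?\<omega> = (\<rho> * ?s / 2) *\<^sub>R (1, - ?e)" using False by (simp add: boundary_multiplier_def)
    have "(max 0 (excess (u t)))\<^sup>2 \<le> (excess (u t))\<^sup>2" for t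
      by (simp add: max_def)
    then have "?T (u t) \<le> ?M t" for t
      using \<rho> by (intro mult_left_mono divide_right_mono) auto
    moreover have "two_jet ?M (- (?\<omega> \<bullet> a)) (boundary_curvature \<rho> w a - ?\<omega> \<bullet> b)"
    proof -
      have "two_jet ?M (\<rho> / 2 * (?s * (?e \<bullet> snd a - fst a)))
          (\<rho> / 2 * ((?e \<bullet> snd a - fst a)\<^sup>2
             + ?s * (((norm (snd a))\<^sup>2 - (?e \<bullet> snd a)\<^sup>2) / norm (snd w) + ?e \<bullet> snd b - fst b)))"
        using two_jet_mult_right[OF two_jet_half_square[OF jet], of "\<rho> / 2"] u0 by simp
      moreover have "\<rho> / 2 * (?s * (?e \<bullet> snd a - fst a)) = - (?\<omega> \<bullet> a)"
        by (simp add: \<omega> inner_prod_def algebra_simps)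
      moreover have "\<rho> / 2 * ((?e \<bullet> snd a - fst a)\<^sup>2
          + ?s * (((norm (snd a))\<^sup>2 - (?e \<bullet> snd a)\<^sup>2) / norm (snd w) + ?e \<bullet> snd b - fst b))
          = boundary_curvature \<rho> w a - ?\<omega> \<bullet> b"
        by (simp add: boundary_curvature_def \<omega> inner_prod_def distrib_left right_diff_distrib mult.assoc)
      ultimately show ?thesis by (simp only:)
    qed
    ultimately show ?thesis using False u0
      by (intro exI[of _ ?M] exI conjI) (auto intro: always_eventually simp: max_def)
  qed
qed

text \<open>This compares the true curvature of the penalty with the form allowed in the second-order
  condition.  Write \<open>a = A d\<close>, let \<open>\<beta>\<close> be the component of its tail along \<open>snd w\<close>, and put
  \<open>t = \<beta> - fst a\<close>, so that \<open>t\<close> is, up to a factor, the product of \<open>a\<close> with the reflected vector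
  \<open>(norm (snd w), snd w)\<close>.  The tangential part of the curvature has the coefficient
  \<open>\<omega>\<^sub>0 / norm (snd w)\<close>, which is at most \<open>c = \<omega>\<^sub>0 / fst w\<close> since the multiplier \<open>\<omega>\<close> vanishes unless
  \<open>fst w < norm (snd w)\<close>.  What the sigma-term leaves over is
  \<open>c * (\<beta>\<^sup>2 - (fst a)\<^sup>2) = 2 * c * \<beta> * t - c * t\<^sup>2\<close>.  By the weighted inequality of
  arithmetic and geometric means the mixed term is at least \<open>- \<epsilon> * \<beta>\<^sup>2 - c\<^sup>2 / \<epsilon> * t\<^sup>2\<close>, so an
  arbitrarily small multiple of the identity and a large coefficient \<open>\<gamma>\<close> compensate it.\<close>

lemma boundary_curvature_bound:
  fixes w :: "('d::finite) svec" and A :: "'a::real_normed_vector \<Rightarrow> 'd svec"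
  assumes w: "fst w > 0" "snd w \<noteq> 0" and A: "bounded_linear A" and \<rho>: "\<rho> \<ge> 0" and \<delta>: "\<delta> > 0"
  obtains \<gamma> where "\<And>d. boundary_curvature \<rho> w (A d) \<le>
     - (fst (boundary_multiplier \<rho> w) / fst w) * (A d \<bullet> reflect_tail (A d))
       + \<gamma> * (A d \<bullet> reflect_tail (norm (snd w), snd w))\<^sup>2 + \<delta> * (norm d)\<^sup>2"
proof -
  obtain N where N: "N > 0" "\<And>d. norm (A d) \<le> norm d * N"
    using bounded_linear.pos_bounded[OF A] by blast
  define n where "n = norm (snd w)"
  define l where "l = fst (boundary_multiplier \<rho> w)"
  define c where "c = l / fst w"
  define \<epsilon> where "\<epsilon> = \<delta> / N\<^sup>2"
  \<comment> \<open>Large enough to cover all multiples of \<open>t\<^sup>2\<close>; the factor \<open>n\<^sup>2\<close> is \<open>(norm (snd w))\<^sup>2\<close> from the reflected vector.\<close>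
  define \<gamma> where "\<gamma> = (\<rho> / 2 + c + c\<^sup>2 / \<epsilon>) / n\<^sup>2"
  have n: "n > 0" using w by (simp add: n_def)
  have \<epsilon>: "\<epsilon> > 0" using \<delta> N(1) by (simp add: \<epsilon>_def)
  have l: "l \<ge> 0" using \<rho> by (simp add: l_def boundary_multiplier_def)
  have lc: "l / n \<le> c"
  proof (cases "excess w > 0")
    case True
    then show ?thesis unfolding c_def using w(1) l n
      by (intro divide_left_mono mult_pos_pos) (auto simp: excess_def n_def)
  next
    case False
    then show ?thesis by (simp add: c_def l_def boundary_multiplier_def)
  qed
  show thesis
  proof (rule that[of \<gamma>])
    fix d
    define a0 where "a0 = fst (A d)"
    define r where "r = (norm (snd (A d)))\<^sup>2"
    define \<beta> where "\<beta> = sgn (snd w) \<bullet> snd (A d)"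
    \<comment> \<open>Up to the factor \<open>- n\<close> this is the product of \<open>A d\<close> with the reflected vector.\<close>
    define t where "t = \<beta> - a0"
    have \<beta>r: "\<beta>\<^sup>2 \<le> r" unfolding \<beta>_def r_def by (rule sgn_inner_le_norm)
    have "snd w = n *\<^sub>R sgn (snd w)" using n by (simp add: n_def sgn_div_norm)
    then have "snd w \<bullet> snd (A d) = n * \<beta>" unfolding \<beta>_def by (metis inner_scaleR_left)
    then have tilde: "(A d \<bullet> reflect_tail (norm (snd w), snd w))\<^sup>2 = n\<^sup>2 * t\<^sup>2"
      by (simp add: reflect_tail_def inner_prod_def n_def[symmetric] a0_def[symmetric] t_def
          inner_commute power_mult_distrib[symmetric])
         (simp add: algebra_simps power2_commute)
    have \<Gamma>: "A d \<bullet> reflect_tail (A d) = a0\<^sup>2 - r"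
      by (simp add: reflect_tail_def inner_prod_def a0_def r_def dot_square_norm power2_eq_square[of "fst (A d)"])
    have "norm (snd (A d)) \<le> norm (A d)" using norm_snd_le[of "snd (A d)" "fst (A d)"] by simp
    then have "r \<le> (norm (A d))\<^sup>2" unfolding r_def by (rule power_mono) simp
    also have "\<dots> \<le> (norm d * N)\<^sup>2" by (rule power_mono[OF N(2)]) simp
    finally have "\<epsilon> * \<beta>\<^sup>2 \<le> \<epsilon> * (norm d * N)\<^sup>2" using \<beta>r \<epsilon> by (intro mult_left_mono) auto
    also have "\<dots> = \<delta> * (norm d)\<^sup>2" using N(1) by (simp add: \<epsilon>_def power_mult_distrib)
    finally have small: "\<epsilon> * \<beta>\<^sup>2 \<le> \<delta> * (norm d)\<^sup>2" .
    have "0 \<le> (\<epsilon> * \<beta> + c * t)\<^sup>2 / \<epsilon>" using \<epsilon> by simp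
    also have "\<dots> = \<epsilon> * \<beta>\<^sup>2 + 2 * c * \<beta> * t + c\<^sup>2 / \<epsilon> * t\<^sup>2"
      using \<epsilon> by (simp add: power2_eq_square field_simps)
    finally have young: "0 \<le> \<epsilon> * \<beta>\<^sup>2 + 2 * c * \<beta> * t + c\<^sup>2 / \<epsilon> * t\<^sup>2" .
    have "l / n * (r - \<beta>\<^sup>2) \<le> c * (r - \<beta>\<^sup>2)" using lc \<beta>r by (intro mult_right_mono) auto
    moreover have "c * (r - \<beta>\<^sup>2) = - c * (a0\<^sup>2 - r) - 2 * c * \<beta> * t + c * t\<^sup>2"
      by (simp add: t_def power2_eq_square algebra_simps)
    moreover have "\<gamma> * (n\<^sup>2 * t\<^sup>2) = \<rho> / 2 * t\<^sup>2 + c * t\<^sup>2 + c\<^sup>2 / \<epsilon> * t\<^sup>2"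
    proof -
      have "\<gamma> * n\<^sup>2 = \<rho> / 2 + c + c\<^sup>2 / \<epsilon>" using n by (simp add: \<gamma>_def)
      then show ?thesis by (simp only: mult.assoc[symmetric] distrib_right)
    qed
    ultimately have "\<rho> / 2 * t\<^sup>2 + l / n * (r - \<beta>\<^sup>2)
        \<le> - c * (a0\<^sup>2 - r) + \<gamma> * (n\<^sup>2 * t\<^sup>2) + \<delta> * (norm d)\<^sup>2"
      using young small by linarith
    moreover have "boundary_curvature \<rho> w (A d) = \<rho> / 2 * t\<^sup>2 + l / n * (r - \<beta>\<^sup>2)"
      by (simp add: boundary_curvature_def t_def \<beta>_def a0_def l_def n_def r_def)
    ultimately show "boundary_curvature \<rho> w (A d) \<le>
     - (fst (boundary_multiplier \<rho> w) / fst w) * (A d \<bullet> reflect_tail (A d))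
       + \<gamma> * (A d \<bullet> reflect_tail (norm (snd w), snd w))\<^sup>2 + \<delta> * (norm d)\<^sup>2"
      unfolding tilde \<Gamma> by (simp add: c_def l_def)
  qed
qed

section \<open>Optimality conditions for the penalized problem\<close>

lemma two_jet_quartic:
  fixes y xs :: "'a::real_inner"
  shows "two_jet (\<lambda>t. 1/4 * norm (y + t *\<^sub>R d - xs) ^ 4) (d \<bullet> ((norm (y - xs))\<^sup>2 *\<^sub>R (y - xs)))
    (2 * ((y - xs) \<bullet> d)\<^sup>2 + (norm (y - xs))\<^sup>2 * (norm d)\<^sup>2)"
proof -
  have "two_jet (\<lambda>t. y + t *\<^sub>R d - xs) d 0"
    using two_jet_diff[OF two_jet_line two_jet_const[of xs]] by simp
  note jet = two_jet_mult_right[OF two_jet_half_square[OF two_jet_inner_self[OF this]], of "1/2"]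
  have "1/2 * ((z \<bullet> z)\<^sup>2 / 2) = 1/4 * norm z ^ 4" for z :: 'a
    by (simp add: power2_norm_eq_inner[symmetric])
  moreover have "1/2 * ((P \<bullet> P) * (2 * (P \<bullet> d))) = d \<bullet> ((norm P)\<^sup>2 *\<^sub>R P)" for P
    by (simp add: power2_norm_eq_inner inner_commute)
  moreover have "1/2 * ((2 * (P \<bullet> d))\<^sup>2 + (P \<bullet> P) * (2 * (d \<bullet> d) + 2 * (P \<bullet> 0)))
      = 2 * (P \<bullet> d)\<^sup>2 + (norm P)\<^sup>2 * (norm d)\<^sup>2" for P
    by (simp add: power2_norm_eq_inner power_mult_distrib distrib_left)
  ultimately show ?thesis using jet by (simp only: scaleR_zero_left add_0_right)
qed

text \<open>At a local minimizer of the penalized function, replace every block penalty by its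
  majorant and restrict to the line through \<open>y\<close> in direction \<open>d\<close>.  The first and second derivatives at
  \<open>0\<close> are those of the Lagrangian with the multipliers \<open>\<rho> *\<^sub>R h y\<close> and \<open>\<omega>\<close>, plus the contributions of
  the quartic term, of \<open>h\<close> and of the curvatures \<open>R i\<close>.\<close>

lemma penalized_second_order_conditions:
  fixes f :: "real^'n::finite \<Rightarrow> real"
    and g :: "real^'n \<Rightarrow> ('d::finite) svec^'r::finite"
    and h :: "real^'n \<Rightarrow> real^'p::finite"
    and T :: "'r \<Rightarrow> 'd svec \<Rightarrow> real" and R :: "'r \<Rightarrow> 'd svec \<Rightarrow> real"
  assumes C2: "twice_cont_diff f" "twice_cont_diff g" "twice_cont_diff h"
    and T: "\<And>i. majorized_at (T i) (g y $ i) (\<omega> $ i) (R i)"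
    and min: "\<forall>\<^sub>F x in nhds y.
      f y + 1/4 * norm (y - xs) ^ 4 + \<rho> / 2 * (norm (h y))\<^sup>2 + (\<Sum>i\<in>UNIV. T i (g y $ i))
      \<le> f x + 1/4 * norm (x - xs) ^ 4 + \<rho> / 2 * (norm (h x))\<^sup>2 + (\<Sum>i\<in>UNIV. T i (g x $ i))"
  defines "L \<equiv> \<lambda>x. lagrangian f g h x (\<rho> *\<^sub>R h y) \<omega>"
  shows "grad L y = - ((norm (y - xs))\<^sup>2 *\<^sub>R (y - xs))"
    and "0 \<le> d \<bullet> hess L y d + 3 * (norm (y - xs))\<^sup>2 * (norm d)\<^sup>2
      + \<rho> * (\<Sum>i\<in>UNIV. (d \<bullet> grad (\<lambda>x. h x $ i) y)\<^sup>2) + (\<Sum>i\<in>UNIV. R i (Dcomp g i y d))"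
proof -
  let ?G = "(norm (y - xs))\<^sup>2 *\<^sub>R (y - xs)"
  have C2L: "twice_cont_diff L"
  proof -
    have "bounded_linear (\<lambda>v. - (v \<bullet> \<omega>))"
      by (intro bounded_linear_minus bounded_linear_inner_left)
    from twice_cont_diff_add[OF twice_cont_diff_add[OF C2(1)
          twice_cont_diff_linear[OF bounded_linear_inner_left C2(3), of "\<rho> *\<^sub>R h y"]]
        twice_cont_diff_linear[OF this C2(2)]]
    show ?thesis by (simp add: L_def lagrangian_def)
  qed
  have C2g: "twice_cont_diff (\<lambda>x. g x $ i)" and C2h: "twice_cont_diff (\<lambda>x. h x $ j)" for i j
    using twice_cont_diff_linear[OF bounded_linear_vec_nth] C2 by blast+
  have both: "d \<bullet> grad L y + d \<bullet> ?G = 0 \<and>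
     0 \<le> d \<bullet> hess L y d + 3 * (norm (y - xs))\<^sup>2 * (norm d)\<^sup>2
      + \<rho> * (\<Sum>i\<in>UNIV. (d \<bullet> grad (\<lambda>x. h x $ i) y)\<^sup>2) + (\<Sum>i\<in>UNIV. R i (Dcomp g i y d))" for d
  proof -
    define l where "l = (\<lambda>t. y + t *\<^sub>R d)"
    have l0: "l 0 = y" by (simp add: l_def)
    define f1 f2 where "f1 = d \<bullet> grad f y" and "f2 = d \<bullet> hess f y d"
    define h1 h2 where "h1 = (\<lambda>j. d \<bullet> grad (\<lambda>x. h x $ j) y)"
      and "h2 = (\<lambda>j. d \<bullet> hess (\<lambda>x. h x $ j) y d)"
    define a where "a = (\<lambda>i. Dcomp g i y d)"
    have jf: "two_jet (\<lambda>t. f (l t)) f1 f2"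
      unfolding l_def f1_def f2_def by (rule two_jet_gradient_hessian[OF C2(1)])
    have jh: "two_jet (\<lambda>t. h (l t) $ j) (h1 j) (h2 j)" for j
      unfolding l_def h1_def h2_def by (rule two_jet_gradient_hessian[OF C2h])
    have "\<forall>i. \<exists>B. two_jet (\<lambda>t. g (l t) $ i) (a i) B"
      unfolding l_def a_def Dcomp_def by (rule allI) (rule twice_cont_diff_line[OF C2g], rule exI)
    from choice[OF this] obtain b where jg: "\<And>i. two_jet (\<lambda>t. g (l t) $ i) (a i) (b i)" by blast
    have L: "L x = f x + (\<Sum>j\<in>UNIV. h x $ j * (\<rho> * h y $ j)) - (\<Sum>i\<in>UNIV. g x $ i \<bullet> \<omega> $ i)" for x
      by (simp add: L_def lagrangian_def inner_vec_def[of "h x"] inner_vec_def[of "g x"]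
          sum_distrib_left mult.left_commute)
    have jL: "two_jet (\<lambda>t. L (l t)) (f1 + (\<Sum>j\<in>UNIV. h1 j * (\<rho> * h y $ j)) - (\<Sum>i\<in>UNIV. a i \<bullet> \<omega> $ i))
        (f2 + (\<Sum>j\<in>UNIV. h2 j * (\<rho> * h y $ j)) - (\<Sum>i\<in>UNIV. b i \<bullet> \<omega> $ i))"
      unfolding L
      by (intro two_jet_add two_jet_diff two_jet_sum jf two_jet_inner_left jg
          two_jet_linear[OF bounded_linear_mult_left] jh finite)
    have jL': "two_jet (\<lambda>t. L (l t)) (d \<bullet> grad L y) (d \<bullet> hess L y d)"
      unfolding l_def by (rule two_jet_gradient_hessian[OF C2L])
    have L1: "d \<bullet> grad L y = f1 + \<rho> * (\<Sum>j\<in>UNIV. h y $ j * h1 j) - (\<Sum>i\<in>UNIV. \<omega> $ i \<bullet> a i)"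
      and L2: "d \<bullet> hess L y d = f2 + \<rho> * (\<Sum>j\<in>UNIV. h y $ j * h2 j) - (\<Sum>i\<in>UNIV. \<omega> $ i \<bullet> b i)"
      unfolding two_jet_unique[OF jL' jL] by (simp_all add: sum_distrib_left inner_commute mult_ac)
    define majorant where "majorant = (\<lambda>i M c. M 0 = T i (g y $ i) \<and>
        (\<forall>\<^sub>F t in nhds 0. T i (g (l t) $ i) \<le> M t) \<and>
        two_jet M (- (\<omega> $ i \<bullet> a i)) c \<and> c \<le> R i (a i) - \<omega> $ i \<bullet> b i)"
    have "\<exists>M c. majorant i M c" for i
      using T[of i, unfolded majorized_at_def, rule_format, OF conjI, OF jg[of i]]
      unfolding majorant_def l0 by blast
    then obtain M c where "\<And>i. majorant i (M i) (c i)" by metis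
    then have M: "\<And>i. M i 0 = T i (g y $ i)"
        "\<And>i. \<forall>\<^sub>F t in nhds 0. T i (g (l t) $ i) \<le> M i t"
        "\<And>i. two_jet (M i) (- (\<omega> $ i \<bullet> a i)) (c i)" "\<And>i. c i \<le> R i (a i) - \<omega> $ i \<bullet> b i"
      unfolding majorant_def by blast+
    define \<Psi> where "\<Psi> = (\<lambda>t. f (l t) + 1/4 * norm (l t - xs) ^ 4
        + \<rho> / 2 * (\<Sum>j\<in>UNIV. h (l t) $ j * h (l t) $ j) + (\<Sum>i\<in>UNIV. M i t))"
    let ?q2 = "2 * ((y - xs) \<bullet> d)\<^sup>2 + (norm (y - xs))\<^sup>2 * (norm d)\<^sup>2"
    have jq: "two_jet (\<lambda>t. 1/4 * norm (l t - xs) ^ 4) (d \<bullet> ?G) ?q2"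
      unfolding l_def by (rule two_jet_quartic)
    have jh2: "two_jet (\<lambda>t. h (l t) $ j * h (l t) $ j) (2 * (h y $ j * h1 j))
        (2 * (h1 j * h1 j) + 2 * (h y $ j * h2 j))" for j
      using two_jet_inner_self[OF jh] by (simp add: l0)
    have j\<Psi>: "two_jet \<Psi> (f1 + d \<bullet> ?G + \<rho> / 2 * (\<Sum>j\<in>UNIV. 2 * (h y $ j * h1 j)) + (\<Sum>i\<in>UNIV. - (\<omega> $ i \<bullet> a i)))
        (f2 + ?q2 + \<rho> / 2 * (\<Sum>j\<in>UNIV. 2 * (h1 j * h1 j) + 2 * (h y $ j * h2 j)) + (\<Sum>i\<in>UNIV. c i))"
      unfolding \<Psi>_def
      by (rule two_jet_add two_jet_sum jf jq jh2 M(3) finite two_jet_mult_right)+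
    have norm_h: "(norm (h x))\<^sup>2 = (\<Sum>j\<in>UNIV. h x $ j * h x $ j)" for x
      by (simp add: power2_norm_eq_inner inner_vec_def)
    have "(l \<longlongrightarrow> y) (nhds 0)"
      using two_jet_continuous[OF two_jet_line[of y d]] by (simp add: l_def)
    from eventually_compose_filterlim[OF min this]
    have "\<forall>\<^sub>F t in nhds 0. f y + 1/4 * norm (y - xs) ^ 4 + \<rho> / 2 * (norm (h y))\<^sup>2 + (\<Sum>i\<in>UNIV. T i (g y $ i))
      \<le> f (l t) + 1/4 * norm (l t - xs) ^ 4 + \<rho> / 2 * (norm (h (l t)))\<^sup>2 + (\<Sum>i\<in>UNIV. T i (g (l t) $ i))" .
    moreover have "\<forall>\<^sub>F t in nhds 0. \<forall>i\<in>UNIV. T i (g (l t) $ i) \<le> M i t"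
      by (rule eventually_ball_finite) (use M(2) in auto)
    ultimately have "\<forall>\<^sub>F t in nhds 0. \<Psi> 0 \<le> \<Psi> t"
    proof eventually_elim
      case (elim t)
      have "(\<Sum>i\<in>UNIV. T i (g (l t) $ i)) \<le> (\<Sum>i\<in>UNIV. M i t)" using elim(2) by (intro sum_mono) auto
      then show ?case using elim(1) by (simp add: \<Psi>_def l0 M(1) norm_h)
    qed
    note crit = two_jet_local_min[OF j\<Psi> this]
    have "d \<bullet> grad L y + d \<bullet> ?G = 0"
      using crit(1) by (simp add: L1 sum_negf sum_distrib_left[symmetric])
    \<comment> \<open>Together with the second summand of the Hessian this gives the constant \<open>3\<close>.\<close>
    moreover have "((y - xs) \<bullet> d)\<^sup>2 \<le> (norm (y - xs))\<^sup>2 * (norm d)\<^sup>2"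
      using Cauchy_Schwarz_ineq[of "y - xs" d] by (simp add: power2_norm_eq_inner)
    moreover have "(\<Sum>i\<in>UNIV. c i) \<le> (\<Sum>i\<in>UNIV. R i (a i)) - (\<Sum>i\<in>UNIV. \<omega> $ i \<bullet> b i)"
      unfolding sum_subtractf[symmetric] by (rule sum_mono) (rule M(4))
    moreover have "\<rho> / 2 * (\<Sum>j\<in>UNIV. 2 * (h1 j * h1 j) + 2 * (h y $ j * h2 j))
        = \<rho> * (\<Sum>j\<in>UNIV. (h1 j)\<^sup>2) + \<rho> * (\<Sum>j\<in>UNIV. h y $ j * h2 j)"
      by (simp add: sum.distrib sum_distrib_left[symmetric] power2_eq_square distrib_left)
    moreover have "(\<Sum>j\<in>UNIV. (d \<bullet> grad (\<lambda>x. h x $ j) y)\<^sup>2) = (\<Sum>j\<in>UNIV. (h1 j)\<^sup>2)"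
      and "(\<Sum>i\<in>UNIV. R i (Dcomp g i y d)) = (\<Sum>i\<in>UNIV. R i (a i))"
      by (simp_all only: h1_def a_def)
    ultimately show ?thesis using crit(2) L2 by (simp only: mult.assoc simp_thms)
  qed
  have "\<forall>d. d \<bullet> grad L y = d \<bullet> (- ?G)"
  proof
    show "d \<bullet> grad L y = d \<bullet> (- ?G)" for d
      using both[of d] by (simp only: inner_minus_right) linarith
  qed
  then show "grad L y = - ?G" by (simp only: vector_eq_ldot)
  show "0 \<le> d \<bullet> hess L y d + 3 * (norm (y - xs))\<^sup>2 * (norm d)\<^sup>2
      + \<rho> * (\<Sum>i\<in>UNIV. (d \<bullet> grad (\<lambda>x. h x $ i) y)\<^sup>2) + (\<Sum>i\<in>UNIV. R i (Dcomp g i y d))"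
    using both[of d] by blast
qed

section \<open>The penalty adapted to the reference point\<close>

text \<open>The penalty of a block depends on its position relative to the cone at the reference point.
  Blocks at the apex are penalized by the squared distance.  For blocks on the nonzero boundary,
  half the square of the excess equals the squared distance near the reference point and is
  explicit.  Interior blocks stay interior near the reference point.\<close>

definition violation ::
  "('r \<Rightarrow> 'd::finite set) \<Rightarrow> ('a \<Rightarrow> 'd svec^'r::finite) \<Rightarrow> 'a \<Rightarrow> 'r \<Rightarrow> 'd svec \<Rightarrow> real" where
  "violation J g xs i w =
     (if i \<in> I_zero g xs then (infdist w (soc (J i)))\<^sup>2
      else if i \<in> I_bd J g xs then (max 0 (excess w))\<^sup>2 / 2 else 0)"

definition block_multiplier ::
  "('r \<Rightarrow> 'd::finite set) \<Rightarrow> ('a \<Rightarrow> 'd svec^'r::finite) \<Rightarrow> 'a \<Rightarrow> real \<Rightarrow> 'r \<Rightarrow> 'd svec \<Rightarrow> 'd svec" where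
  "block_multiplier J g xs \<rho> i w =
     (if i \<in> I_zero g xs then \<rho> *\<^sub>R (closest_point (soc (J i)) w - w)
      else if i \<in> I_bd J g xs then boundary_multiplier \<rho> w else 0)"

definition block_curvature ::
  "('r \<Rightarrow> 'd::finite set) \<Rightarrow> ('a \<Rightarrow> 'd svec^'r::finite) \<Rightarrow> 'a \<Rightarrow> real \<Rightarrow> 'r \<Rightarrow> 'd svec \<Rightarrow> 'd svec \<Rightarrow> real" where
  "block_curvature J g xs \<rho> i w a =
     (if i \<in> I_zero g xs then \<rho> * (norm a)\<^sup>2
      else if i \<in> I_bd J g xs then boundary_curvature \<rho> w a else 0)"

lemma I_zero_I_bd_disjoint: "I_zero g xs \<inter> I_bd J g xs = {}"
  by (auto simp: I_zero_def I_bd_def soc_bdp_def)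

lemma I_int_disjoint: "i \<in> I_int J g xs \<Longrightarrow> i \<notin> I_zero g xs \<and> i \<notin> I_bd J g xs"
  by (auto simp: I_zero_def I_bd_def I_int_def soc_bdp_def soc_int_def)

lemma majorized_at_violation:
  assumes "\<rho> \<ge> 0" and "i \<in> I_bd J g xs \<Longrightarrow> snd w \<noteq> 0"
  shows "majorized_at (\<lambda>w. \<rho> / 2 * violation J g xs i w) w (block_multiplier J g xs \<rho> i w)
    (block_curvature J g xs \<rho> i w)"
proof -
  have "soc (J i) \<noteq> {}" using zero_in_soc by blast
  then have 1: "majorized_at (\<lambda>w. \<rho> / 2 * (infdist w (soc (J i)))\<^sup>2) w
      (\<rho> *\<^sub>R (closest_point (soc (J i)) w - w)) (\<lambda>a. \<rho> * (norm a)\<^sup>2)"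
    by (rule majorized_at_infdist_square[OF closed_soc _ assms(1)])
  show ?thesis
  proof (cases "i \<in> I_zero g xs")
    case True
    show ?thesis using 1 unfolding violation_def block_multiplier_def block_curvature_def if_P[OF True] .
  next
    case False
    show ?thesis
    proof (cases "i \<in> I_bd J g xs")
      case True
      show ?thesis
        using majorized_at_excess_square[OF assms(2)[OF True] assms(1)]
        unfolding violation_def block_multiplier_def block_curvature_def if_P[OF True] if_not_P[OF False] .
    next
      case nb: False
      show ?thesis
        using majorized_at_zero
        unfolding violation_def block_multiplier_def block_curvature_def if_not_P[OF nb] if_not_P[OF False]
        by simp
    qed
  qed
qed

lemma block_multiplier_in_soc:
  assumes "w \<in> soc_space (J i)" and "\<rho> \<ge> 0"
  shows "block_multiplier J g xs \<rho> i w \<in> soc (J i)"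
  using boundary_multiplier_in_soc[OF assms] zero_in_soc[of "J i"]
    soc_scaleR[OF assms(2) closest_point_residual_in_soc[OF assms(1)]]
  by (simp add: block_multiplier_def)

lemma violation_nonneg: "violation J g xs i w \<ge> 0"
  by (simp add: violation_def)

lemma in_soc_if_no_violation:
  assumes "xs \<in> feasible_set J g h" and w: "w \<in> soc_space (J i)"
    and "violation J g xs i w = 0" and "i \<in> I_int J g xs \<Longrightarrow> norm (snd w) < fst w"
  shows "w \<in> soc (J i)"
proof -
  consider "i \<in> I_zero g xs" | "i \<in> I_bd J g xs" "i \<notin> I_zero g xs" | "i \<in> I_int J g xs"
    using feasible_block_cases[OF assms(1), of i] by blast
  then show ?thesis
  proof cases
    case 1
    then have "infdist w (soc (J i)) = 0" using assms(3) by (simp add: violation_def)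
    then show ?thesis using in_closed_iff_infdist_zero[OF closed_soc] zero_in_soc by blast
  next
    case 2
    then have "excess w \<le> 0" using assms(3) by (simp add: violation_def max_def split: if_splits)
    then show ?thesis using w by (simp add: soc_def excess_def)
  next
    case 3
    then show ?thesis using w assms(4) by (simp add: soc_def)
  qed
qed

lemma continuous_on_violation:
  assumes "continuous_on S u"
  shows "continuous_on S (\<lambda>x. violation J g xs i (u x))"
  unfolding violation_def excess_def
  by (cases "i \<in> I_zero g xs"; cases "i \<in> I_bd J g xs")
     (auto intro!: continuous_intros assms)

text \<open>The adjoints disappear from the quadratic form of the second-order condition; only values of
  the component derivatives at \<open>d\<close> remain, which is what the curvature bounds speak about.\<close>

lemma inner_hessian_sum:
  fixes g :: "real^'n::finite \<Rightarrow> ('d::finite) svec^'r::finite" and h :: "real^'n \<Rightarrow> real^'p::finite"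
  assumes "\<And>i. linear (Dcomp g i x)"
  shows "d \<bullet> (H + sigma_term J g xs x \<omega> d
        + (\<Sum>i\<in>UNIV. (\<eta> $ i) *\<^sub>R outer (grad (\<lambda>y. h y $ i) x) d)
        + (\<Sum>i\<in>I_bd J g xs. \<gamma> i *\<^sub>R
             outer (adjoint (Dcomp g i x) (reflect_tail (g_tilde g i x))) d)
        + (\<Sum>i\<in>I_zero g xs. \<theta> i *\<^sub>R adjoint (Dcomp g i x) (Dcomp g i x d))
        + \<delta> *\<^sub>R d)
     = d \<bullet> H + (\<Sum>i\<in>I_bd J g xs. - (fst (\<omega> $ i) / fst (g x $ i)) * (Dcomp g i x d \<bullet> reflect_tail (Dcomp g i x d)))
        + (\<Sum>i\<in>UNIV. \<eta> $ i * (d \<bullet> grad (\<lambda>y. h y $ i) x)\<^sup>2)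
        + (\<Sum>i\<in>I_bd J g xs. \<gamma> i * (Dcomp g i x d \<bullet> reflect_tail (g_tilde g i x))\<^sup>2)
        + (\<Sum>i\<in>I_zero g xs. \<theta> i * (norm (Dcomp g i x d))\<^sup>2) + \<delta> * (norm d)\<^sup>2"
proof -
  have outer: "d \<bullet> outer v d = (d \<bullet> v)\<^sup>2" for v :: "real^'n"
    by (simp add: outer_def inner_commute power2_eq_square)
  have adj: "d \<bullet> adjoint (Dcomp g i x) z = Dcomp g i x d \<bullet> z" for i z
    by (rule adjoint_works[OF assms])
  show ?thesis
    unfolding sigma_term_def
    by (simp only: inner_add_right inner_sum_right inner_scaleR_right outer adj power2_norm_eq_inner)
qed

text \<open>Minimizers of the penalized functions on a small ball converge to \<open>xs\<close>; on a subsequence the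
  set of boundary blocks with a nonzero multiplier is constant.  This is needed because the AKKT
  conditions ask each boundary block either to have multipliers tending to \<open>0\<close> or to have all
  of them nonzero.\<close>

theorem theorem4p9:
  fixes f :: "real^'n::finite \<Rightarrow> real"
    and g :: "real^'n \<Rightarrow> ('d::finite) svec^'r::finite"
    and h :: "real^'n \<Rightarrow> real^'p::finite"
    and J :: "'r \<Rightarrow> 'd set"
    and xs :: "real^'n"
  assumes g_range: "\<And>x i. g x $ i \<in> soc_space (J i)"
    and C2: "twice_cont_diff f" "twice_cont_diff g" "twice_cont_diff h"
    and locmin: "local_minimizer_on (feasible_set J g h) f xs"
    and alt:
      "(\<forall>(\<rho> :: nat \<Rightarrow> real) (x :: nat \<Rightarrow> real^'n).
          filterlim \<rho> at_top sequentially \<longrightarrow> x \<longlonglongrightarrow> xs \<longrightarrow>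
          (\<forall>k. local_minimizer_on UNIV (penalty J f g h xs (\<rho> k)) (x k)) \<longrightarrow>
          (\<forall>i \<in> I_bd J g xs.
             bounded ((\<lambda>k. fst (\<rho> k *\<^sub>R closest_point (soc (J i)) (- (g (x k) $ i)))) `
               {k. g (x k) $ i \<in> soc_space (J i) - (soc (J i) \<union> uminus ` soc (J i))})))
       \<or> gen_lojasiewicz (feas_measure J g h) xs"
  shows "AKKT2 J f g h xs"
proof -
  let ?F = "feasible_set J g h" and ?B = "I_bd J g xs" and ?Z = "I_zero g xs"
  have feas: "xs \<in> ?F" using locmin by (simp add: local_minimizer_on_def)
  obtain e0 where e0: "e0 > 0" "\<And>z. z \<in> ?F \<Longrightarrow> z \<in> ball xs e0 \<Longrightarrow> f xs \<le> f z"
    using locmin unfolding local_minimizer_on_def by blast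
  note cont_f = twice_cont_diff_continuous[OF C2(1)]
    and cont_g = twice_cont_diff_continuous[OF C2(2)]
    and cont_h = twice_cont_diff_continuous[OF C2(3)]
  have g_lim: "((\<lambda>z. g z $ i) \<longlongrightarrow> g xs $ i) (nhds xs)" for i
    using cont_g[of UNIV] by (intro tendsto_vec_nth)
      (simp add: continuous_on_eq_continuous_at isCont_def tendsto_at_iff_tendsto_nhds)
  \<comment> \<open>Near \<open>xs\<close> interior blocks stay interior, and boundary blocks stay in the region where the excess is smooth.\<close>
  define good where "good = (\<lambda>z. \<forall>i. (i \<in> I_int J g xs \<longrightarrow> norm (snd (g z $ i)) < fst (g z $ i)) \<and>
      (i \<in> ?B \<longrightarrow> fst (g z $ i) > 0 \<and> snd (g z $ i) \<noteq> 0))"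
  have bd_xs: "fst (g xs $ i) > 0" "snd (g xs $ i) \<noteq> 0" if "i \<in> ?B" for i
    using that by (auto simp: I_bd_def soc_bdp_def)
  have "\<forall>\<^sub>F z in nhds xs. (i \<in> I_int J g xs \<longrightarrow> norm (snd (g z $ i)) < fst (g z $ i)) \<and>
      (i \<in> ?B \<longrightarrow> fst (g z $ i) > 0 \<and> snd (g z $ i) \<noteq> 0)" for i
  proof -
    have "\<forall>\<^sub>F z in nhds xs. excess (g z $ i) < 0" if "i \<in> I_int J g xs"
    proof (rule order_tendstoD(2))
      show "((\<lambda>z. excess (g z $ i)) \<longlongrightarrow> excess (g xs $ i)) (nhds xs)"
        unfolding excess_def by (intro tendsto_intros g_lim)
      show "excess (g xs $ i) < 0" using that by (simp add: I_int_def soc_int_def excess_def)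
    qed
    moreover have "\<forall>\<^sub>F z in nhds xs. fst (g z $ i) > 0" if "i \<in> ?B"
      by (rule order_tendstoD(1)[OF tendsto_fst[OF g_lim] bd_xs(1)[OF that]])
    moreover have "\<forall>\<^sub>F z in nhds xs. snd (g z $ i) \<noteq> 0" if "i \<in> ?B"
      by (rule tendsto_imp_eventually_ne[OF tendsto_snd[OF g_lim] bd_xs(2)[OF that]])
    ultimately show ?thesis
      by (auto simp: excess_def eventually_conj_iff)
  qed
  then have "\<forall>\<^sub>F z in nhds xs. good z"
    unfolding good_def by (subst eventually_all_finite) auto
  then obtain e1 where e1: "e1 > 0" "\<And>z. dist z xs < e1 \<Longrightarrow> good z"
    unfolding eventually_nhds_metric by blast
  define e where "e = min e0 e1 / 2"
  have e: "e > 0" "e < e0" "e < e1" using e0(1) e1(1) by (auto simp: e_def)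
  have good: "good z" if "z \<in> cball xs e" for z
    using that e e1(2)[of z] by (simp add: dist_commute)
  define P where "P = (\<lambda>z. (norm (h z))\<^sup>2 + (\<Sum>i\<in>UNIV. violation J g xs i (g z $ i)))"
  have "\<exists>x. x \<longlonglongrightarrow> xs \<and> (\<forall>k. \<forall>z\<in>cball xs e. f (x k) + 1/4 * norm (x k - xs) ^ 4 + real k / 2 * P (x k)
      \<le> f z + 1/4 * norm (z - xs) ^ 4 + real k / 2 * P z)"
  proof (rule penalty_minimizers_converge[OF e(1), of xs f "\<lambda>z. 1/4 * norm (z - xs) ^ 4" P])
    show "continuous_on (cball xs e) P"
      unfolding P_def by (intro continuous_intros continuous_on_violation cont_g cont_h)
    show "0 \<le> P z" for z
      unfolding P_def by (intro add_nonneg_nonneg sum_nonneg violation_nonneg) simp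
    have "violation J g xs i (g xs $ i) = 0" for i
      using feas by (auto simp: violation_def excess_def feasible_set_def soc_def)
    then show "P xs = 0" using feas by (simp add: P_def feasible_set_def)
    fix z assume z: "z \<in> cball xs e" and "P z = 0"
    then have h: "h z = 0" and v: "\<And>i. violation J g xs i (g z $ i) = 0"
      unfolding P_def by (simp_all add: add_nonneg_eq_0_iff sum_nonneg sum_nonneg_eq_0_iff violation_nonneg)
    have "g z $ i \<in> soc (J i)" for i
      using in_soc_if_no_violation[OF feas g_range v] good[OF z] by (simp add: good_def)
    then show "f xs \<le> f z" using h z e by (intro e0(2)) (auto simp: feasible_set_def)
  qed (auto intro!: continuous_intros cont_f)
  then obtain x where x: "x \<longlonglongrightarrow> xs"
    "\<And>k z. z \<in> cball xs e \<Longrightarrow> f (x k) + 1/4 * norm (x k - xs) ^ 4 + real k / 2 * P (x k)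
      \<le> f z + 1/4 * norm (z - xs) ^ 4 + real k / 2 * P z" by blast
  define A where "A = (\<lambda>k. {i \<in> ?B. excess (g (x k) $ i) > 0})"
  have "\<forall>\<^sub>F k in sequentially. k > 0 \<and> dist (x k) xs < e"
    using x(1) e(1) by (intro eventually_conj eventually_gt_at_top tendstoD)
  then have "infinite {k. k > 0 \<and> dist (x k) xs < e}"
    by (simp add: frequently_cofinite[symmetric] cofinite_eq_sequentially eventually_frequently)
  moreover have "finite (A ` {k. k > 0 \<and> dist (x k) xs < e})" by simp
  ultimately have "\<exists>k0\<in>{k. k > 0 \<and> dist (x k) xs < e}.
      infinite {k \<in> {k. k > 0 \<and> dist (x k) xs < e}. A k = A k0}"
    by (rule pigeonhole_infinite)
  then obtain k0 where "infinite {k \<in> {k. k > 0 \<and> dist (x k) xs < e}. A k = A k0}" by blast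
  from infinite_enumerate[OF this] obtain r :: "nat \<Rightarrow> nat" where r: "strict_mono r"
    "\<And>k. r k > 0 \<and> dist (x (r k)) xs < e \<and> A (r k) = A k0"
    by auto
  define y where "y = (\<lambda>k. x (r k))"
  define \<rho> where "\<rho> = (\<lambda>k. real (r k))"
  have y: "y \<longlonglongrightarrow> xs" unfolding y_def
    using LIMSEQ_subseq_LIMSEQ[OF x(1) r(1)] by (simp add: o_def)
  have \<rho>: "\<rho> k > 0" for k using r(2)[of k] by (simp add: \<rho>_def)
  have y_ball: "y k \<in> ball xs e" for k using r(2)[of k] by (simp add: y_def dist_commute)
  have good_y: "good (y k)" for k using good y_ball[of k] by simp
  define \<mu> where "\<mu> = (\<lambda>k. \<rho> k *\<^sub>R h (y k))"
  define \<omega> :: "nat \<Rightarrow> 'd svec^'r"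
    where "\<omega> = (\<lambda>k. \<chi> i. block_multiplier J g xs (\<rho> k) i (g (y k) $ i))"
  have \<omega>_nth: "\<omega> k $ i = block_multiplier J g xs (\<rho> k) i (g (y k) $ i)" for k i
    by (simp add: \<omega>_def)
  have \<omega>_B: "\<omega> k $ i = boundary_multiplier (\<rho> k) (g (y k) $ i)" if "i \<in> ?B" for k i
    using that I_zero_I_bd_disjoint[of g xs J] by (auto simp: \<omega>_nth block_multiplier_def)
  have maj: "majorized_at (\<lambda>w. \<rho> k / 2 * violation J g xs i w) (g (y k) $ i) (\<omega> k $ i)
      (block_curvature J g xs (\<rho> k) i (g (y k) $ i))" for k i
    unfolding \<omega>_nth
    using \<rho>[of k] good_y[of k] by (intro majorized_at_violation) (auto simp: good_def)
  have min: "\<forall>\<^sub>F z in nhds (y k). f (y k) + 1/4 * norm (y k - xs) ^ 4 + \<rho> k / 2 * (norm (h (y k)))\<^sup>2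
        + (\<Sum>i\<in>UNIV. \<rho> k / 2 * violation J g xs i (g (y k) $ i))
      \<le> f z + 1/4 * norm (z - xs) ^ 4 + \<rho> k / 2 * (norm (h z))\<^sup>2
        + (\<Sum>i\<in>UNIV. \<rho> k / 2 * violation J g xs i (g z $ i))" for k
  proof -
    have "\<forall>\<^sub>F z in nhds (y k). z \<in> ball xs e"
      by (rule eventually_nhds_in_open) (use y_ball in auto)
    then show ?thesis
    proof eventually_elim
      case (elim z)
      then have "z \<in> cball xs e" by simp
      from x(2)[OF this, of "r k"] show ?case
        by (simp only: P_def y_def \<rho>_def distrib_left sum_distrib_left add.assoc)
    qed
  qed
  note second_order = penalized_second_order_conditions[OF C2 maj min, folded \<mu>_def]
  have lin: "bounded_linear (Dcomp g i z)" for i z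
  proof -
    obtain g' where "(g has_derivative g') (at z)" using C2(2) unfolding twice_cont_diff_def by blast
    then have "((\<lambda>z. g z $ i) has_derivative (\<lambda>d. g' d $ i)) (at z)"
      by (rule bounded_linear.has_derivative[OF bounded_linear_vec_nth])
    then have "(\<lambda>z. g z $ i) differentiable (at z)" by (rule differentiableI)
    then show ?thesis unfolding Dcomp_def frechet_derivative_works
      by (rule has_derivative_bounded_linear)
  qed
  define absorbs where "absorbs = (\<lambda>k i \<gamma>. i \<in> ?B \<longrightarrow>
     (\<forall>d. boundary_curvature (\<rho> k) (g (y k) $ i) (Dcomp g i (y k) d) \<le>
       - (fst (\<omega> k $ i) / fst (g (y k) $ i)) * (Dcomp g i (y k) d \<bullet> reflect_tail (Dcomp g i (y k) d))
       + \<gamma> * (Dcomp g i (y k) d \<bullet> reflect_tail (g_tilde g i (y k)))\<^sup>2 + inverse (real (Suc k)) * (norm d)\<^sup>2))"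
  have "\<exists>\<gamma>. absorbs k i \<gamma>" for k i
  proof (cases "i \<in> ?B")
    case True
    have w: "fst (g (y k) $ i) > 0" "snd (g (y k) $ i) \<noteq> 0" using good_y[of k] True by (auto simp: good_def)
    have "inverse (real (Suc k)) > 0" by simp
    from boundary_curvature_bound[OF w lin[of i "y k"] less_imp_le[OF \<rho>[of k]] this]
    show ?thesis unfolding absorbs_def \<omega>_B[OF True] g_tilde_def by blast
  qed (simp add: absorbs_def)
  then have "\<forall>k. \<exists>\<gamma>. \<forall>i. absorbs k i (\<gamma> i)" by (intro allI choice) blast
  from choice[OF this] obtain \<gamma> where \<gamma>: "\<And>k i. absorbs k i (\<gamma> k i)" by blast
  \<comment> \<open>The factor \<open>3\<close> bounds the Hessian of the quartic term; every boundary block contributes one \<open>1 / (k + 1)\<close>.\<close>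
  define \<delta> where "\<delta> = (\<lambda>k. 3 * (norm (y k - xs))\<^sup>2 + real (card ?B) * inverse (real (Suc k)))"
  define \<eta> :: "nat \<Rightarrow> real^'p" where "\<eta> = (\<lambda>k. \<chi> i. \<rho> k)"
  have y0: "(\<lambda>k. norm (y k - xs)) \<longlonglongrightarrow> 0" using y by (simp add: LIM_zero tendsto_norm_zero)
  have AKKT: "AKKT_sequences J f g h xs y \<mu> \<omega>"
    unfolding AKKT_sequences_def
  proof (intro conjI allI ballI feas y)
    show "\<omega> k \<in> prod_soc J" for k
      unfolding prod_soc_def mem_Collect_eq \<omega>_nth
      by (intro allI block_multiplier_in_soc g_range less_imp_le[OF \<rho>])
    have "(\<lambda>k. - ((norm (y k - xs))\<^sup>2 *\<^sub>R (y k - xs))) \<longlonglongrightarrow> - ((0::real)\<^sup>2 *\<^sub>R (xs - xs))"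
      by (intro tendsto_intros y0 y)
    then show "(\<lambda>k. grad (\<lambda>z. lagrangian f g h z (\<mu> k) (\<omega> k)) (y k)) \<longlonglongrightarrow> 0"
      unfolding \<mu>_def second_order(1) by simp
    show "(\<lambda>k. \<omega> k $ i) \<longlonglongrightarrow> 0" if "i \<in> I_int J g xs" for i
      using I_int_disjoint[OF that] by (simp add: \<omega>_nth block_multiplier_def)
    show "(\<lambda>k. \<omega> k $ i) \<longlonglongrightarrow> 0 \<or>
        (\<forall>k. \<omega> k $ i \<in> soc_bdp (J i)) \<and>
        (\<lambda>k. snd (\<omega> k $ i) /\<^sub>R norm (snd (\<omega> k $ i)))
          \<longlonglongrightarrow> - (snd (g xs $ i) /\<^sub>R norm (snd (g xs $ i)))" if i: "i \<in> ?B" for i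
    proof (cases "i \<in> A k0")
      case True
      have ex: "excess (g (y k) $ i) > 0" for k
        using True r(2)[of k] by (auto simp: A_def y_def)
      have nz: "snd (g (y k) $ i) \<noteq> 0" for k using good_y[of k] i by (simp add: good_def)
      have act: "\<omega> k $ i \<in> soc_bdp (J i)" "sgn (snd (\<omega> k $ i)) = - sgn (snd (g (y k) $ i))" for k
        unfolding \<omega>_B[OF i] by (rule boundary_multiplier_active[OF g_range nz \<rho> ex])+
      have "(\<lambda>k. - sgn (snd (g (y k) $ i))) \<longlonglongrightarrow> - sgn (snd (g xs $ i))"
        by (intro tendsto_minus tendsto_sgn tendsto_snd bd_xs(2)[OF i] filterlim_compose[OF g_lim y])
      then show ?thesis using act unfolding sgn_div_norm[symmetric] by simp
    next
      case False
      have "excess (g (y k) $ i) \<le> 0" for k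
      proof -
        have "i \<notin> A (r k)" using False r(2)[of k] by simp
        then show ?thesis using i by (simp add: A_def y_def not_less)
      qed
      then show ?thesis by (simp add: \<omega>_B[OF i] boundary_multiplier_inactive)
    qed
  qed
  have \<delta>0: "\<delta> k \<ge> 0" for k by (simp add: \<delta>_def)
  have \<delta>_lim: "\<delta> \<longlonglongrightarrow> 0"
  proof -
    have "\<delta> \<longlonglongrightarrow> 3 * 0\<^sup>2 + real (card ?B) * 0"
      unfolding \<delta>_def by (intro tendsto_intros y0 LIMSEQ_inverse_real_of_nat)
    then show ?thesis by simp
  qed
  have main: "0 \<le> d \<bullet> (hess (\<lambda>z. lagrangian f g h z (\<mu> k) (\<omega> k)) (y k) d
              + sigma_term J g xs (y k) (\<omega> k) d
              + (\<Sum>i\<in>UNIV. (\<eta> k $ i) *\<^sub>R outer (grad (\<lambda>z. h z $ i) (y k)) d)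
              + (\<Sum>i\<in>?B. \<gamma> k i *\<^sub>R
                   outer (adjoint (Dcomp g i (y k)) (reflect_tail (g_tilde g i (y k)))) d)
              + (\<Sum>i\<in>?Z. \<rho> k *\<^sub>R adjoint (Dcomp g i (y k)) (Dcomp g i (y k) d))
              + \<delta> k *\<^sub>R d)" for k d
  proof -
    let ?a = "\<lambda>i. Dcomp g i (y k) d"
    let ?\<sigma> = "\<lambda>i. - (fst (\<omega> k $ i) / fst (g (y k) $ i)) * (?a i \<bullet> reflect_tail (?a i))"
    let ?\<tau> = "\<lambda>i. \<gamma> k i * (?a i \<bullet> reflect_tail (g_tilde g i (y k)))\<^sup>2"
    let ?R = "\<lambda>i. block_curvature J g xs (\<rho> k) i (g (y k) $ i) (?a i)"
    have "(\<Sum>i\<in>UNIV. ?R i) = (\<Sum>i\<in>?Z \<union> ?B. ?R i)"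
      by (rule sum.mono_neutral_right) (auto simp: block_curvature_def)
    then have split: "(\<Sum>i\<in>UNIV. ?R i) = (\<Sum>i\<in>?Z. ?R i) + (\<Sum>i\<in>?B. ?R i)"
      by (simp only: sum.union_disjoint[OF finite finite I_zero_I_bd_disjoint])
    have R_zero: "(\<Sum>i\<in>?Z. ?R i) = (\<Sum>i\<in>?Z. \<rho> k * (norm (?a i))\<^sup>2)"
      by (rule sum.cong) (simp_all add: block_curvature_def)
    have "(\<Sum>i\<in>?B. ?R i) \<le> (\<Sum>i\<in>?B. ?\<sigma> i + ?\<tau> i + inverse (real (Suc k)) * (norm d)\<^sup>2)"
    proof (rule sum_mono)
      fix i assume i: "i \<in> ?B"
      then have "?R i = boundary_curvature (\<rho> k) (g (y k) $ i) (?a i)"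
        using I_zero_I_bd_disjoint[of g xs J] by (auto simp: block_curvature_def)
      moreover have "boundary_curvature (\<rho> k) (g (y k) $ i) (?a i)
          \<le> ?\<sigma> i + ?\<tau> i + inverse (real (Suc k)) * (norm d)\<^sup>2"
        using \<gamma>[of k i] i unfolding absorbs_def by blast
      ultimately show "?R i \<le> ?\<sigma> i + ?\<tau> i + inverse (real (Suc k)) * (norm d)\<^sup>2"
        by (simp only:)
    qed
    then have R_bd: "(\<Sum>i\<in>?B. ?R i) \<le> (\<Sum>i\<in>?B. ?\<sigma> i) + (\<Sum>i\<in>?B. ?\<tau> i)
        + real (card ?B) * inverse (real (Suc k)) * (norm d)\<^sup>2"
      by (simp only: sum.distrib sum_constant mult.assoc)
    have \<eta>: "(\<Sum>i\<in>UNIV. \<eta> k $ i * (d \<bullet> grad (\<lambda>z. h z $ i) (y k))\<^sup>2)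
        = \<rho> k * (\<Sum>i\<in>UNIV. (d \<bullet> grad (\<lambda>z. h z $ i) (y k))\<^sup>2)"
      by (simp add: \<eta>_def sum_distrib_left)
    have \<delta>: "\<delta> k * (norm d)\<^sup>2 = 3 * (norm (y k - xs))\<^sup>2 * (norm d)\<^sup>2
        + real (card ?B) * inverse (real (Suc k)) * (norm d)\<^sup>2"
      by (simp only: \<delta>_def distrib_right)
    have so: "0 \<le> d \<bullet> hess (\<lambda>z. lagrangian f g h z (\<mu> k) (\<omega> k)) (y k) d
        + 3 * (norm (y k - xs))\<^sup>2 * (norm d)\<^sup>2
        + \<rho> k * (\<Sum>i\<in>UNIV. (d \<bullet> grad (\<lambda>z. h z $ i) (y k))\<^sup>2) + (\<Sum>i\<in>UNIV. ?R i)"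
      unfolding \<mu>_def by (rule second_order(2))
    show ?thesis
      unfolding inner_hessian_sum[OF bounded_linear.linear[OF lin]] \<eta> \<delta>
      using so split R_zero R_bd by linarith
  qed
  show ?thesis unfolding AKKT2_def
    by (rule exI[of _ y], rule exI[of _ \<mu>], rule exI[of _ \<omega>], rule exI[of _ \<eta>],
        rule exI[of _ "\<lambda>k i. \<rho> k"], rule exI[of _ \<gamma>], rule exI[of _ \<delta>])
       (intro conjI AKKT allI \<delta>0 \<delta>_lim always_eventually main)
qed

end
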